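(* Let $A\in\mathbb{R}^{n\times n}$, $b\in\mathbb{R}^{n\times m}$, $C\in\mathbb{R}^{n\times n}$, $G=G^\top\in\mathbb{R}^{n\times n}$, $\gamma\in\mathbb{R}^{n\times m}$, $\Gamma=\Gamma^\top\in\mathbb{R}^{m\times m}$, with $\rho(A)<1$, and assume that the system $$x_{t+1}=Ax_t+bu_t+Cx_t\xi_{t+1}\quad(t=0,1,2,\dots),\qquad x_0=a,$$ is stable in the mean-square sense for $u_t\equiv 0$. Let $H,\Theta\in\mathbb{C}^{n\times n}$ be symmetric matrices satisfying $$A^\top HA-H+\Theta=0,\qquad \Theta-C^\top HC-G=0,$$ and put, for $x\in\mathbb{C}^n$, $u\in\mathbb{C}^m$, $z\in\mathbb{C}$, $$\mathcal{F}(x,u)=x^*\Theta x+2\,\mathrm{Re}\,x^*\gamma u+u^*\Gamma u,\qquad g(z)=(zI-A)^{-1}.$$ For $u\in\mathbf{U}=\{(u_t)_{t\ge 0}:u_t\in\mathbb{R}^m,\ \sum_{t=0}^{\infty}|u_t|^2<\infty\}$ let $$\Phi(u)=\sum_{t=0}^{\infty}\mathbf{E}\left[x_t^*Gx_t+2\,\mathrm{Re}\,x_t^*\gamma u_t+u_t^*\Gamma u_t\right],$$ where $(x_t)$ is the solution of the system above corresponding to $u$. Suppose there exists $u^o\in\mathbf{U}$ such that $\Phi(u^o)\le\Phi(u)$ for all $u\in\mathbf{U}$. Then: (i) $\mathcal{F}(g(z)bu,u)\ge 0$ for all $z\in\mathbb{C}$ with $|z|=1$ and all $u\in\mathbb{C}^m$.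 (ii) Furthermore, if there exists $\delta>0$ such that $\mathcal{F}(g(z)bu,u)\ge\delta|u|^2$ for all $z\in\mathbb{C}$ with $|z|=1$ and all $u\in\mathbb{C}^m$, then $u^o$ is unique (up to equivalence).
   Context: $(\Omega,\mathscr{F},\mathbf{P})$ is a standard probability space with a non-decreasing flow of $\sigma$-algebras $\mathscr{F}_t\subset\mathscr{F}$. The scalar real process $\xi_t$ is discrete-time white noise adapted to $\mathscr{F}_t$ with $\mathbf{E}\,\xi_t=0$, $\mathbf{Var}(\xi_t)=1$, where $\xi_{t+1}$ is independent of $\mathscr{F}_t$. The random vector $a$ with values in $\mathbb{R}^n$ is $\mathscr{F}_0$-measurable, independent of $\{\xi_t\}_{t\ge 0}$, with $\mathbf{E}|a|^2<\infty$ and $\mathbf{E}|aa^\top|^2<\infty$. Here $|\cdot|$ is the Euclidean norm for vectors and the Frobenius norm for matrices, $\rho(\cdot)$ is the spectral radius, $^\top$ is transpose, and $^*$ is conjugate transpose. The controls in $\mathbf{U}$ are deterministic sequences. "Unique up to equivalence" means unique as an element of $\ell^2$: any two minimizers $u,v\in\mathbf{U}$ satisfy $\sum_t|u_t-v_t|^2=0$. Mean-square stability for $u_t\equiv 0$ means that the solution of $x_{t+1}=Ax_t+Cx_t\xi_{t+1}$ satisfies $\mathbf{E}|x_t|^2\to 0$ for every $\mathscr{F}_0$-measurable random initial vector $x_0$ with values in $\mathbb{R}^n$ that is independent of $\{\xi_t\}_{t\ge 0}$ and satisfies $\mathbf{E}|x_0|^2<\infty$ and $\mathbf{E}|x_0x_0^\top|^2<\infty$;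 equivalently, $\rho(A\otimes A+C\otimes C)<1$, where $\otimes$ is the Kronecker product. *)

theory Defs
  imports "HOL-Probability.Probability" "HOL-Library.Complex_Order"
begin

section \<open>Linear algebra\<close>

abbreviation cmat :: "real ^ 'c ^ 'r \<Rightarrow> complex ^ 'c ^ 'r" where
  "cmat \<equiv> map_matrix complex_of_real"

text \<open>The product \<open>x\<^sup>* y\<close> on complex column vectors, conjugate-linear in the first argument.\<close>

definition cdot :: "complex ^ 'n \<Rightarrow> complex ^ 'n \<Rightarrow> complex" where
  "cdot x y = (\<Sum>i\<in>UNIV. cnj (x $ i) * y $ i)"

text \<open>\<open>x x\<^sup>T\<close>; the library norm of \<^typ>\<open>real ^ 'n ^ 'n\<close> is the Frobenius norm.\<close>

definition outer_square :: "real ^ 'n \<Rightarrow> real ^ 'n ^ 'n" where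
  "outer_square x = (\<chi> i j. x $ i * x $ j)"

definition eigenvalues :: "complex ^ 'n ^ 'n \<Rightarrow> complex set" where
  "eigenvalues A = {k. \<exists>v. v \<noteq> 0 \<and> A *v v = k *s v}"

definition spectral_radius :: "complex ^ 'n ^ 'n \<Rightarrow> real" where
  "spectral_radius A = (SUP k\<in>eigenvalues A. cmod k)"

section \<open>The stochastic system\<close>

text \<open>Each \<open>\<xi> (Suc t)\<close> is independent of the past \<open>F t\<close>; with adaptedness this makes all the
  \<open>\<xi> t\<close> mutually independent. They need not be identically distributed.\<close>

locale white_noise = prob_space M + filtration "space M" F
  for M :: "'w measure" and F :: "nat \<Rightarrow> 'w measure" +
  fixes \<xi> :: "nat \<Rightarrow> 'w \<Rightarrow> real"
  assumes subalgebra_F: "\<And>t. subalgebra M (F t)"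
    and adapted: "\<And>t. \<xi> t \<in> borel_measurable (F t)"
    and integrable_noise: "\<And>t. integrable M (\<xi> t)"
    and integrable_noise_square: "\<And>t. integrable M (\<lambda>\<omega>. (\<xi> t \<omega>)\<^sup>2)"
    and mean_noise: "\<And>t. expectation (\<xi> t) = 0"
    and variance_noise: "\<And>t. variance (\<xi> t) = 1"
    and indep_noise:
      "\<And>t. indep_set (sets (F t)) (sets (vimage_algebra (space M) (\<xi> (Suc t)) borel))"
begin

text \<open>Independence is from the \<open>\<sigma>\<close>-algebra generated by the whole noise process. The library's
  \<open>indep_var\<close> does not apply, as it needs random variables with values in one type.\<close>

definition initial_vector :: "('w \<Rightarrow> real ^ 'n) \<Rightarrow> bool" where
  "initial_vector a \<longleftrightarrow>
    a \<in> borel_measurable (F 0) \<and>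
    indep_set (sets (vimage_algebra (space M) a borel))
      (sets (vimage_algebra (space M) (\<lambda>\<omega> t. \<xi> t \<omega>) (\<Pi>\<^sub>M t\<in>UNIV. borel))) \<and>
    integrable M (\<lambda>\<omega>. (norm (a \<omega>))\<^sup>2) \<and>
    integrable M (\<lambda>\<omega>. (norm (outer_square (a \<omega>)))\<^sup>2)"

primrec state :: "real ^ 'n ^ 'n \<Rightarrow> real ^ 'm ^ 'n \<Rightarrow> real ^ 'n ^ 'n \<Rightarrow> ('w \<Rightarrow> real ^ 'n)
    \<Rightarrow> (nat \<Rightarrow> real ^ 'm) \<Rightarrow> nat \<Rightarrow> 'w \<Rightarrow> real ^ 'n" where
  "state A b C a u 0 = a"
| "state A b C a u (Suc t) = (\<lambda>\<omega>. A *v state A b C a u t \<omega> + b *v u t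
      + \<xi> (Suc t) \<omega> *\<^sub>R (C *v state A b C a u t \<omega>))"

definition mean_square_stable ::
    "real ^ 'n ^ 'n \<Rightarrow> real ^ 'm ^ 'n \<Rightarrow> real ^ 'n ^ 'n \<Rightarrow> bool" where
  "mean_square_stable A b C \<longleftrightarrow> (\<forall>x\<^sub>0. initial_vector x\<^sub>0 \<longrightarrow>
    (\<lambda>t. expectation (\<lambda>\<omega>. (norm (state A b C x\<^sub>0 (\<lambda>_. 0) t \<omega>))\<^sup>2)) \<longlonglongrightarrow> 0)"

text \<open>The vectors and matrices in the cost are real, so \<open>\<^sup>*\<close> is the transpose and \<open>Re\<close> the identity.
  For a mean-square stable system and a square-summable control all expectations are finite and
  the series converges absolutely, so the default values of integral and sum play no role.\<close>

definition cost :: "real ^ 'n ^ 'n \<Rightarrow> real ^ 'm ^ 'n \<Rightarrow> real ^ 'n ^ 'n \<Rightarrow> real ^ 'n ^ 'n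
    \<Rightarrow> real ^ 'm ^ 'n \<Rightarrow> real ^ 'm ^ 'm \<Rightarrow> ('w \<Rightarrow> real ^ 'n) \<Rightarrow> (nat \<Rightarrow> real ^ 'm) \<Rightarrow> real" where
  "cost A b C G \<gamma> \<Gamma> a u = (\<Sum>t. expectation (\<lambda>\<omega>.
    let x = state A b C a u t \<omega>
    in x \<bullet> (G *v x) + 2 * (x \<bullet> (\<gamma> *v u t)) + u t \<bullet> (\<Gamma> *v u t)))"

end

definition controls :: "(nat \<Rightarrow> real ^ 'm) set" where
  "controls = {u. summable (\<lambda>t. (norm (u t))\<^sup>2)}"

section \<open>Frequency domain\<close>

text \<open>The form is complex valued, since \<open>\<Theta>\<close> is a complex matrix that is only assumed symmetric.
  Inequalities between its values use the order of \<^theory>\<open>HOL-Library.Complex_Order\<close>, where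
  \<open>w \<le> z\<close> means that \<open>z - w\<close> is real and nonnegative.\<close>

definition frequency_form :: "complex ^ 'n ^ 'n \<Rightarrow> real ^ 'm ^ 'n \<Rightarrow> real ^ 'm ^ 'm
    \<Rightarrow> complex ^ 'n \<Rightarrow> complex ^ 'm \<Rightarrow> complex" where
  "frequency_form \<Theta> \<gamma> \<Gamma> x u = cdot x (\<Theta> *v x)
    + complex_of_real (2 * Re (cdot x (cmat \<gamma> *v u))) + cdot u (cmat \<Gamma> *v u)"

definition resolvent :: "real ^ 'n ^ 'n \<Rightarrow> complex \<Rightarrow> complex ^ 'n ^ 'n" where
  "resolvent A z = matrix_inv (mat z - cmat A)"

end

theory Submission
  imports Defs
begin

text \<open>Let \<open>m\<^sub>t = E x\<^sub>t\<close>, a solution of the noise-free system. Mean-square stability makes the Lyapunov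
  operator \<open>L K = A\<^sup>T K A + C\<^sup>T K C\<close> contract to \<open>0\<close> on symmetric matrices. Hence \<open>H = L H + G\<close> forces
  \<open>H\<close> to be real, and \<open>q\<^sub>t = E (x\<^sub>t\<^sup>T H x\<^sub>t) - m\<^sub>t\<^sup>T H m\<^sub>t\<close> tends to \<open>0\<close>. The control enters \<open>x\<^sub>t - m\<^sub>t\<close> only
  through the noise term \<open>C m\<^sub>t\<close>, so \<open>E (x\<^sub>t\<^sup>T G x\<^sub>t) = q\<^sub>t - q\<^bsub>t+1\<^esub> + m\<^sub>t\<^sup>T \<Theta> m\<^sub>t\<close>, and the cost is a constant
  plus the deterministic quadratic cost \<open>J(u) = (\<Sum>t. \<F>(m\<^sub>t, u\<^sub>t))\<close>.

  By the parallelogram identity a minimizer of \<open>J\<close> exists only if the cost \<open>J\<^sub>0\<close> started at \<open>0\<close> is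
  nonnegative. Evaluating \<open>J\<^sub>0\<close> on long truncated sinusoids gives (i): the average cost per step
  tends to the frequency form. Conversely, Parseval's identity on the \<open>M\<close>-th roots of unity turns
  the frequency inequality of (ii) into \<open>J\<^sub>0(u) \<ge> \<delta> |u|\<^sup>2\<close>, and the parallelogram identity for two
  minimizers gives uniqueness.\<close>

section \<open>Orbits of linear maps\<close>

lemma linear_funpow:
  fixes T :: "'a::real_vector \<Rightarrow> 'a"
  assumes "linear T"
  shows "linear (T ^^ k)"
proof (induction k)
  case 0
  then show ?case by (simp add: id_def linear_ident)
next
  case (Suc k)
  then show ?case using linear_compose[OF Suc assms] by (simp add: o_def)
qed

text \<open>In finite dimension pointwise decay of orbits is uniform decay: some power
  \<open>T ^^ N\<close> at least halves every norm. Shifting an orbit sum by \<open>N\<close> then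
  halves it, so the whole sum is controlled by its first \<open>N\<close> terms.\<close>

lemma orbit_sum_bound:
  fixes T :: "'a::euclidean_space \<Rightarrow> 'a"
  assumes T: "linear T" and lim: "\<And>x. (\<lambda>k. (T ^^ k) x) \<longlonglongrightarrow> 0"
  obtains \<kappa> where "\<kappa> > 0" "\<And>x n. (\<Sum>k<n. norm ((T ^^ k) x)) \<le> \<kappa> * norm x"
proof -
  \<comment> \<open>\<open>c k\<close> dominates the operator norm of \<open>T ^^ k\<close> and, as
    a sum over a finite basis, inherits the limit 0.\<close>
  define c where "c k = (\<Sum>i\<in>Basis. norm ((T ^^ k) i))" for k
  have c_nonneg: "c k \<ge> 0" for k
    by (simp add: c_def sum_nonneg)
  have norm_le: "norm ((T ^^ k) x) \<le> c k * norm x" for k x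
  proof -
    interpret Tk: linear "T ^^ k" by (rule linear_funpow[OF T])
    have "(T ^^ k) x = (T ^^ k) (\<Sum>i\<in>Basis. (x \<bullet> i) *\<^sub>R i)"
      by (simp add: euclidean_representation)
    also have "\<dots> = (\<Sum>i\<in>Basis. (x \<bullet> i) *\<^sub>R (T ^^ k) i)"
      by (simp add: Tk.sum Tk.scaleR)
    finally have "norm ((T ^^ k) x) \<le> (\<Sum>i\<in>Basis. \<bar>x \<bullet> i\<bar> * norm ((T ^^ k) i))"
      by (metis (no_types, lifting) norm_scaleR norm_sum sum.cong)
    also have "\<dots> \<le> (\<Sum>i\<in>Basis. norm x * norm ((T ^^ k) i))"
      by (intro sum_mono mult_right_mono Basis_le_norm) auto
    finally show ?thesis by (simp add: c_def sum_distrib_left mult.commute)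
  qed
  have "c \<longlonglongrightarrow> (\<Sum>i\<in>(Basis::'a set). 0)"
    unfolding c_def by (intro tendsto_sum tendsto_norm_zero lim)
  then have "c \<longlonglongrightarrow> 0" by simp
  then have "eventually (\<lambda>k. c k < 1 / 2) sequentially"
    by (rule order_tendstoD) simp
  then obtain N where N: "c N < 1 / 2"
    by (auto simp: eventually_sequentially)
  \<comment> \<open>Solving \<open>s \<le> s_N + s / 2\<close> for \<open>s\<close> gives the factor
    2; the added 1 makes positivity immediate.\<close>
  define \<kappa> where "\<kappa> = 2 * (\<Sum>k<N. c k) + 1"
  have "\<kappa> > 0" by (simp add: \<kappa>_def add_nonneg_pos sum_nonneg c_nonneg)
  moreover have "(\<Sum>k<n. norm ((T ^^ k) x)) \<le> \<kappa> * norm x" for x n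
  proof -
    let ?s = "\<lambda>n. \<Sum>k<n. norm ((T ^^ k) x)"
    have "norm ((T ^^ (k + N)) x) \<le> 1 / 2 * norm ((T ^^ k) x)" for k
    proof -
      have "(T ^^ (k + N)) x = (T ^^ N) ((T ^^ k) x)"
        by (simp add: add.commute[of k] funpow_add)
      then have "norm ((T ^^ (k + N)) x) \<le> c N * norm ((T ^^ k) x)"
        using norm_le by metis
      also have "\<dots> \<le> 1 / 2 * norm ((T ^^ k) x)"
        using N by (intro mult_right_mono) auto
      finally show ?thesis .
    qed
    then have "(\<Sum>k<n. norm ((T ^^ (k + N)) x)) \<le> 1 / 2 * ?s n"
      by (simp only: sum_distrib_left) (rule sum_mono)
    moreover have "?s n \<le> ?s (N + n)"
      by (rule sum_mono2) auto
    moreover have "?s (N + n) = ?s N + (\<Sum>k<n. norm ((T ^^ (k + N)) x))"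
      by (induction n) (simp_all add: add.commute)
    moreover have "?s N \<le> (\<Sum>k<N. c k) * norm x"
      by (simp add: sum_distrib_right sum_mono norm_le)
    ultimately show ?thesis
      using norm_ge_zero[of x] unfolding \<kappa>_def distrib_right by linarith
  qed
  ultimately show thesis using that by blast
qed

text \<open>An l2 version of the discrete Gronwall inequality. Convexity of the square keeps the
  contraction factor \<open>q\<close> for the squares, at the price of the factor
  \<open>1 / (1 - q)\<close> on the input.\<close>

lemma square_summable_recursion:
  fixes r e :: "nat \<Rightarrow> real"
  assumes r: "\<And>t. 0 \<le> r t" and q: "0 \<le> q" "q < 1"
    and step: "\<And>t. r (Suc t) \<le> q * r t + e t"
    and e: "summable (\<lambda>t. (e t)\<^sup>2)"
  shows "summable (\<lambda>t. (r t)\<^sup>2)"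
proof -
  have sq: "(r (Suc t))\<^sup>2 \<le> q * (r t)\<^sup>2 + (e t)\<^sup>2 / (1 - q)" for t
  proof -
    have "(r (Suc t))\<^sup>2 \<le> (q * r t + e t)\<^sup>2"
      using r step by (intro power_mono)
    \<comment> \<open>The square is taken at the convex combination of \<open>r t\<close> and
      \<open>e t / (1 - q)\<close> with weights \<open>q\<close> and \<open>1 - q\<close>; the
      subtracted term is the convexity defect.\<close>
    also have "\<dots> = q * (r t)\<^sup>2 + (e t)\<^sup>2 / (1 - q) - q / (1 - q) * ((1 - q) * r t - e t)\<^sup>2"
    proof -
      define d where "d = 1 - q"
      have "d > 0" "q = 1 - d" using q by (auto simp: d_def)
      then show ?thesis
        unfolding \<open>q = 1 - d\<close> by (simp add: field_simps power2_eq_square)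
    qed
    also have "\<dots> \<le> q * (r t)\<^sup>2 + (e t)\<^sup>2 / (1 - q)"
      using q by simp
    finally show ?thesis .
  qed
  define E where "E = (\<Sum>t. (e t)\<^sup>2) / (1 - q)"
  \<comment> \<open>A partial sum \<open>s\<close> satisfies
    \<open>s \<le> (r 0)\<^sup>2 + q * s + E\<close>; absorbing \<open>q * s\<close> on the left
    bounds it independently of \<open>n\<close>.\<close>
  have "(\<Sum>t<n. (r t)\<^sup>2) \<le> ((r 0)\<^sup>2 + E) / (1 - q)" for n
  proof -
    have "(\<Sum>t<n. (r t)\<^sup>2) \<le> (\<Sum>t<Suc n. (r t)\<^sup>2)"
      by simp
    also have "\<dots> = (r 0)\<^sup>2 + (\<Sum>t<n. (r (Suc t))\<^sup>2)"
      by (rule sum.lessThan_Suc_shift)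
    also have "\<dots> \<le> (r 0)\<^sup>2 + (\<Sum>t<n. q * (r t)\<^sup>2 + (e t)\<^sup>2 / (1 - q))"
      by (intro add_left_mono sum_mono sq)
    also have "\<dots> = (r 0)\<^sup>2 + q * (\<Sum>t<n. (r t)\<^sup>2) + (\<Sum>t<n. (e t)\<^sup>2) / (1 - q)"
      by (simp add: sum.distrib sum_distrib_left sum_divide_distrib)
    also have "\<dots> \<le> (r 0)\<^sup>2 + q * (\<Sum>t<n. (r t)\<^sup>2) + E"
      unfolding E_def using q by (intro add_left_mono divide_right_mono sum_le_suminf e) auto
    finally have "(1 - q) * (\<Sum>t<n. (r t)\<^sup>2) \<le> (r 0)\<^sup>2 + E"
      by (simp add: algebra_simps)
    then show ?thesis
      using q by (simp add: field_simps)
  qed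
  then show ?thesis
    by (intro summableI_nonneg_bounded) auto
qed

lemma square_summable_add:
  fixes u v :: "nat \<Rightarrow> 'c::real_inner"
  assumes u: "summable (\<lambda>t. (norm (u t))\<^sup>2)" and v: "summable (\<lambda>t. (norm (v t))\<^sup>2)"
  shows "summable (\<lambda>t. (norm (u t + v t))\<^sup>2)"
proof (rule summable_comparison_test'[where N = 0])
  show "summable (\<lambda>t. 2 * (norm (u t))\<^sup>2 + 2 * (norm (v t))\<^sup>2)"
    by (intro summable_add summable_mult u v)
  have "(norm (x + y))\<^sup>2 \<le> 2 * (norm x)\<^sup>2 + 2 * (norm y)\<^sup>2" for x y :: 'c
    using zero_le_power2[of "norm (x - y)"] unfolding power2_norm_eq_inner
    by (simp add: inner_add inner_diff inner_commute)
  then show "norm ((norm (u t + v t))\<^sup>2) \<le> 2 * (norm (u t))\<^sup>2 + 2 * (norm (v t))\<^sup>2" for t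
    by simp
qed

section \<open>Deterministic linear-quadratic control\<close>

locale linear_system =
  fixes A :: "'a::euclidean_space \<Rightarrow> 'a" and B :: "'b::euclidean_space \<Rightarrow> 'a"
  assumes linear_A: "linear A" and linear_B: "linear B"
begin

sublocale A: linear A by (rule linear_A)
sublocale B: linear B by (rule linear_B)

primrec trajectory :: "'a \<Rightarrow> (nat \<Rightarrow> 'b) \<Rightarrow> nat \<Rightarrow> 'a" where
  "trajectory x u 0 = x"
| "trajectory x u (Suc t) = A (trajectory x u t) + B (u t)"

lemma trajectory_add: "trajectory (x + y) (\<lambda>t. u t + v t) t = trajectory x u t + trajectory y v t"
  by (induction t) (simp_all add: A.add B.add)

lemma trajectory_diff: "trajectory (x - y) (\<lambda>t. u t - v t) t = trajectory x u t - trajectory y v t"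
  by (induction t) (simp_all add: A.diff B.diff)

lemma linear_powA: "linear (A ^^ k)"
  by (rule linear_funpow[OF linear_A])

lemma trajectory_free:
  assumes "\<And>t. t \<ge> N \<Longrightarrow> u t = 0"
  shows "trajectory x u (k + N) = (A ^^ k) (trajectory x u N)"
  by (induction k) (simp_all add: assms B.zero)

text \<open>Complex vectors are pairs of real and imaginary parts: the condition below reads
  \<open>z (g + i h) = A (g + i h) + B (v + i w)\<close> with \<open>z = exp (i \<theta>)\<close>.\<close>

definition harmonic :: "real \<Rightarrow> 'a \<Rightarrow> 'a \<Rightarrow> 'b \<Rightarrow> 'b \<Rightarrow> bool" where
  "harmonic \<theta> g h v w \<longleftrightarrow>
    cos \<theta> *\<^sub>R g - sin \<theta> *\<^sub>R h = A g + B v \<and> sin \<theta> *\<^sub>R g + cos \<theta> *\<^sub>R h = A h + B w"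

text \<open>This is multiplication of the complex solution by \<open>-i\<close>.\<close>

lemma harmonic_swap:
  assumes "harmonic \<theta> g h v w"
  shows "harmonic \<theta> h (- g) w (- v)"
  using assms by (auto simp: harmonic_def A.neg B.neg algebra_simps)

text \<open>The real part of \<open>exp (i t \<theta>) (g + i h)\<close> solves the recursion for
  the sinusoidal input, but starts at \<open>g\<close>. Subtracting the free orbit of
  \<open>g\<close> moves the start to 0.\<close>

lemma harmonic_trajectory:
  assumes harm: "harmonic \<theta> g h v w"
    and u: "\<And>s. s < N \<Longrightarrow> u s = cos (real s * \<theta>) *\<^sub>R v - sin (real s * \<theta>) *\<^sub>R w"
    and "t \<le> N"
  shows "trajectory 0 u t = cos (real t * \<theta>) *\<^sub>R g - sin (real t * \<theta>) *\<^sub>R h - (A ^^ t) g"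
  using \<open>t \<le> N\<close>
proof (induction t)
  case (Suc t)
  let ?y = "\<lambda>t::nat. cos (real t * \<theta>) *\<^sub>R g - sin (real t * \<theta>) *\<^sub>R h"
  have "A (?y t) + B (u t)
    = cos (real t * \<theta>) *\<^sub>R (A g + B v) - sin (real t * \<theta>) *\<^sub>R (A h + B w)"
    using Suc.prems by (simp add: u A.diff A.scale B.diff B.scale algebra_simps)
  also have "\<dots> = cos (real t * \<theta>) *\<^sub>R (cos \<theta> *\<^sub>R g - sin \<theta> *\<^sub>R h)
      - sin (real t * \<theta>) *\<^sub>R (sin \<theta> *\<^sub>R g + cos \<theta> *\<^sub>R h)"
    using harm by (simp add: harmonic_def)
  also have "\<dots> = ?y (Suc t)"
    by (simp add: cos_add sin_add distrib_right algebra_simps)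
  finally have step: "A (?y t) + B (u t) = ?y (Suc t)" .
  have "trajectory 0 u t = ?y t - (A ^^ t) g"
    using Suc by simp
  then show ?case
    unfolding trajectory.simps step[symmetric] by (simp add: A.diff)
qed simp

end

section \<open>Quadratic cost of a stable linear system\<close>

locale stable_linear_system = linear_system A B
  for A :: "'a::euclidean_space \<Rightarrow> 'a" and B :: "'b::euclidean_space \<Rightarrow> 'a" +
  fixes S :: "'a \<times> 'b \<Rightarrow> 'a \<times> 'b"
  assumes linear_S: "linear S"
    and orbit_limit: "\<And>x. (\<lambda>k. (A ^^ k) x) \<longlonglongrightarrow> 0"
begin

sublocale S: linear S by (rule linear_S)

definition form :: "'a \<times> 'b \<Rightarrow> real" where
  "form p = p \<bullet> S p"

definition quadratic_cost :: "'a \<Rightarrow> (nat \<Rightarrow> 'b) \<Rightarrow> real" where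
  "quadratic_cost x u = (\<Sum>t. form (trajectory x u t, u t))"

definition S_bound :: real where
  "S_bound = (SOME K. K > 0 \<and> (\<forall>p. norm (S p) \<le> norm p * K))"

lemma S_bound: "S_bound > 0" "norm (S p) \<le> S_bound * norm p"
proof -
  have "\<exists>K>0. \<forall>p. norm (S p) \<le> norm p * K"
    using bounded_linear.pos_bounded[OF linear_conv_bounded_linear[THEN iffD1, OF linear_S]] by blast
  from someI_ex[OF this] show "S_bound > 0" "norm (S p) \<le> S_bound * norm p"
    unfolding S_bound_def mult.commute[of _ "norm _"] by blast+
qed

lemma abs_form_le: "\<bar>form p\<bar> \<le> S_bound * (norm p)\<^sup>2"
proof -
  have "\<bar>form p\<bar> \<le> norm p * norm (S p)"
    unfolding form_def by (rule Cauchy_Schwarz_ineq2)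
  also have "\<dots> \<le> norm p * (S_bound * norm p)"
    by (intro mult_left_mono S_bound) auto
  finally show ?thesis by (simp add: power2_eq_square mult_ac)
qed

lemma form_perturb: "\<bar>form (p + e) - form p\<bar> \<le> S_bound * (2 * norm p * norm e + (norm e)\<^sup>2)"
proof -
  have "form (p + e) - form p = p \<bullet> S e + e \<bullet> S p + e \<bullet> S e"
    unfolding form_def by (simp add: S.add inner_add_left inner_add_right)
  also have "\<bar>\<dots>\<bar> \<le> \<bar>p \<bullet> S e\<bar> + \<bar>e \<bullet> S p\<bar> + \<bar>e \<bullet> S e\<bar>"
    by linarith
  also have "\<dots> \<le> norm p * norm (S e) + norm e * norm (S p) + norm e * norm (S e)"
    by (intro add_mono Cauchy_Schwarz_ineq2)
  also have "\<dots> \<le> norm p * (S_bound * norm e) + norm e * (S_bound * norm p) + norm e * (S_bound * norm e)"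
    by (intro add_mono mult_left_mono S_bound) auto
  finally show ?thesis by (simp add: power2_eq_square algebra_simps)
qed

lemma form_parallelogram: "form (p + e) + form (p - e) = 2 * form p + 2 * form e"
  unfolding form_def by (simp add: S.add S.diff algebra_simps)

text \<open>\<open>form p + form q\<close> is the real part of the sesquilinear extension of the
  form at \<open>p + i q\<close>, which does not change when the vector is multiplied by
  \<open>exp (i \<phi>)\<close>.\<close>

lemma form_rotate:
  "form (cos \<phi> *\<^sub>R p - sin \<phi> *\<^sub>R q) + form (sin \<phi> *\<^sub>R p + cos \<phi> *\<^sub>R q) = form p + form q"
proof -
  have "form (c *\<^sub>R p - s *\<^sub>R q) + form (s *\<^sub>R p + c *\<^sub>R q) = (s\<^sup>2 + c\<^sup>2) * (form p + form q)" for c s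
    unfolding form_def
    by (simp add: S.add S.diff S.scale algebra_simps power2_eq_square)
  from this[of "cos \<phi>" "sin \<phi>"] show ?thesis
    by simp
qed

lemma orbit_bounds:
  obtains \<kappa> where "\<kappa> > 0" "\<And>x. summable (\<lambda>k. norm ((A ^^ k) x))"
    "\<And>x. (\<Sum>k. norm ((A ^^ k) x)) \<le> \<kappa> * norm x"
    "\<And>x n. (\<Sum>k<n. norm ((A ^^ k) x)) \<le> \<kappa> * norm x"
    "\<And>x k. norm ((A ^^ k) x) \<le> \<kappa> * norm x"
proof -
  obtain \<kappa> where \<kappa>: "\<kappa> > 0" "\<And>x n. (\<Sum>k<n. norm ((A ^^ k) x)) \<le> \<kappa> * norm x"
    using orbit_sum_bound[OF linear_A orbit_limit] by blast
  have summ: "summable (\<lambda>k. norm ((A ^^ k) x))" for x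
    by (rule summableI_nonneg_bounded[OF _ \<kappa>(2)]) auto
  have "norm ((A ^^ k) x) \<le> (\<Sum>j<Suc k. norm ((A ^^ j) x))" for x k
    by (simp add: sum_nonneg)
  then have "norm ((A ^^ k) x) \<le> \<kappa> * norm x" for x k
    using \<kappa>(2) order_trans by blast
  moreover have "(\<Sum>k. norm ((A ^^ k) x)) \<le> \<kappa> * norm x" for x
    by (intro suminf_le_const summ \<kappa>)
  ultimately show thesis using that \<kappa> summ by blast
qed

text \<open>The sum \<open>N x\<close> of the norms along the free orbit of \<open>x\<close> is an
  adapted norm in which \<open>A\<close> is a strict contraction. In this norm the state obeys the
  scalar recursion of \<open>square_summable_recursion\<close>.\<close>

lemma square_summable_trajectory:
  assumes u: "summable (\<lambda>t. (norm (u t))\<^sup>2)"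
  shows "summable (\<lambda>t. (norm (trajectory x u t))\<^sup>2)"
proof -
  obtain \<kappa> where \<kappa>: "\<kappa> > 0" "\<And>x. summable (\<lambda>k. norm ((A ^^ k) x))"
    "\<And>x. (\<Sum>k. norm ((A ^^ k) x)) \<le> \<kappa> * norm x"
    using orbit_bounds by metis
  define N where "N x = (\<Sum>k. norm ((A ^^ k) x))" for x
  have N_nonneg: "0 \<le> N x" for x
    unfolding N_def by (intro suminf_nonneg \<kappa>) auto
  \<comment> \<open>Applying \<open>A\<close> drops the first term of the series. Together with
    \<open>N x \<le> \<kappa>' * norm x\<close> this yields the contraction factor
    \<open>1 - 1 / \<kappa>'\<close>.\<close>
  have N_A: "N (A x) = N x - norm x" for x
    using suminf_split_head[OF \<kappa>(2)[of x]] by (simp add: N_def funpow_swap1)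
  have norm_N: "norm x \<le> N x" for x
    using N_A[of x] N_nonneg[of "A x"] by simp
  have N_add: "N (x + y) \<le> N x + N y" for x y
  proof -
    have "N (x + y) \<le> (\<Sum>k. norm ((A ^^ k) x) + norm ((A ^^ k) y))"
      unfolding N_def using linear_add[OF linear_powA]
      by (intro suminf_le \<kappa> summable_add) (simp add: norm_triangle_ineq)
    also have "\<dots> = N x + N y"
      unfolding N_def by (intro suminf_add[symmetric] \<kappa>)
    finally show ?thesis .
  qed
  obtain c where c: "c > 0" "\<And>v. norm (B v) \<le> norm v * c"
    using bounded_linear.pos_bounded[OF linear_conv_bounded_linear[THEN iffD1, OF linear_B]] by blast
  \<comment> \<open>The increase by 1 places \<open>1 - 1 / \<kappa>'\<close> strictly between 0 and
    1.\<close>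
  define \<kappa>' where "\<kappa>' = \<kappa> + 1"
  have \<kappa>': "\<kappa>' > 1" "N x \<le> \<kappa>' * norm x" for x
    using \<kappa>(1) add_increasing2[OF norm_ge_zero \<kappa>(3)[of x], of x] by (simp_all add: \<kappa>'_def N_def distrib_right)
  have "N (trajectory x u (Suc t)) \<le> (1 - 1 / \<kappa>') * N (trajectory x u t) + \<kappa>' * c * norm (u t)" for t
  proof -
    let ?m = "trajectory x u t"
    have "N (trajectory x u (Suc t)) \<le> N (A ?m) + N (B (u t))"
      by (simp add: N_add)
    moreover have "N (A ?m) \<le> (1 - 1 / \<kappa>') * N ?m"
      using \<kappa>'(2)[of ?m] \<kappa>'(1) by (simp add: N_A field_simps)
    moreover have "N (B (u t)) \<le> \<kappa>' * (norm (u t) * c)"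
      using \<kappa>'(2)[of "B (u t)"] mult_left_mono[OF c(2)[of "u t"], of \<kappa>'] \<kappa>'(1) by linarith
    ultimately show ?thesis by (simp add: mult_ac)
  qed
  moreover have "summable (\<lambda>t. (\<kappa>' * c * norm (u t))\<^sup>2)"
    unfolding power_mult_distrib by (intro summable_mult u)
  ultimately have "summable (\<lambda>t. (N (trajectory x u t))\<^sup>2)"
    by (rule square_summable_recursion[where q = "1 - 1 / \<kappa>'", OF N_nonneg, rotated 2])
      (use \<kappa>'(1) in simp_all)
  then show ?thesis
    by (rule summable_comparison_test'[where N = 0]) (simp add: power_mono norm_N)
qed

lemma summable_norm_pair:
  assumes u: "summable (\<lambda>t. (norm (u t))\<^sup>2)"
  shows "summable (\<lambda>t. (norm (trajectory x u t, u t))\<^sup>2)"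
  using summable_add[OF square_summable_trajectory[OF u] u]
  by (simp add: norm_Pair)

lemma summable_form:
  assumes u: "summable (\<lambda>t. (norm (u t))\<^sup>2)"
  shows "summable (\<lambda>t. form (trajectory x u t, u t))"
  by (rule summable_comparison_test'[where N = 0, OF summable_mult[OF summable_norm_pair[OF u]]])
    (use abs_form_le in auto)

text \<open>The state depends affinely on the control: a change \<open>v\<close> of the control adds
  the trajectory of \<open>v\<close> started at 0. This is why the last cost has initial state 0
  while the other three keep \<open>x\<close>.\<close>

lemma quadratic_cost_parallelogram:
  assumes u: "summable (\<lambda>t. (norm (u t))\<^sup>2)" and v: "summable (\<lambda>t. (norm (v t))\<^sup>2)"
  shows "quadratic_cost x (\<lambda>t. u t + v t) + quadratic_cost x (\<lambda>t. u t - v t)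
    = 2 * quadratic_cost x u + 2 * quadratic_cost 0 v"
proof -
  have add: "summable (\<lambda>t. (norm (u t + v t))\<^sup>2)" and diff: "summable (\<lambda>t. (norm (u t - v t))\<^sup>2)"
    using square_summable_add[OF u v] square_summable_add[OF u, of "\<lambda>t. - v t"] v by auto
  have "quadratic_cost x (\<lambda>t. u t + v t) + quadratic_cost x (\<lambda>t. u t - v t)
    = (\<Sum>t. form (trajectory x (\<lambda>t. u t + v t) t, u t + v t)
        + form (trajectory x (\<lambda>t. u t - v t) t, u t - v t))"
    unfolding quadratic_cost_def by (intro suminf_add summable_form add diff)
  also have "\<dots> = (\<Sum>t. 2 * form (trajectory x u t, u t) + 2 * form (trajectory 0 v t, v t))"
    using trajectory_add[of x 0 u v] trajectory_diff[of x 0 u v]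
      form_parallelogram[of "(trajectory x u t, u t)" "(trajectory 0 v t, v t)" for t]
    by simp
  also have "\<dots> = 2 * quadratic_cost x u + 2 * quadratic_cost 0 v"
    unfolding quadratic_cost_def suminf_mult[OF summable_form[OF u], symmetric]
      suminf_mult[OF summable_form[OF v], symmetric]
    by (intro suminf_add[symmetric] summable_mult summable_form u v)
  finally show ?thesis .
qed

text \<open>A nonzero solution would be an eigenvector of \<open>A\<close> for an eigenvalue on the
  unit circle. The squared norms of its real and imaginary orbits have constant sum, against decay.
  This later makes the resolvent a genuine inverse on the circle.\<close>

lemma harmonic_zero:
  assumes harm: "harmonic \<theta> g h 0 0"
  shows "g = 0 \<and> h = 0"
proof -
  have zero: "trajectory 0 (\<lambda>_. 0) t = 0" for t
    by (induction t) (simp_all add: A.zero B.zero)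
  have orbits: "(A ^^ t) g = cos (real t * \<theta>) *\<^sub>R g - sin (real t * \<theta>) *\<^sub>R h"
    "(A ^^ t) h = cos (real t * \<theta>) *\<^sub>R h + sin (real t * \<theta>) *\<^sub>R g" for t
    using harmonic_trajectory[OF harm, of t "\<lambda>_. 0" t]
      harmonic_trajectory[OF harmonic_swap[OF harm], of t "\<lambda>_. 0" t]
    by (simp_all add: zero)
  have "(norm (c *\<^sub>R g - s *\<^sub>R h))\<^sup>2 + (norm (c *\<^sub>R h + s *\<^sub>R g))\<^sup>2
      = (s\<^sup>2 + c\<^sup>2) * ((norm g)\<^sup>2 + (norm h)\<^sup>2)" for c s
    unfolding power2_norm_eq_inner by (simp add: algebra_simps power2_eq_square inner_commute)
  then have "(norm ((A ^^ t) g))\<^sup>2 + (norm ((A ^^ t) h))\<^sup>2 = (norm g)\<^sup>2 + (norm h)\<^sup>2" for t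
    unfolding orbits by simp
  moreover have "(\<lambda>t. (norm ((A ^^ t) g))\<^sup>2 + (norm ((A ^^ t) h))\<^sup>2) \<longlonglongrightarrow> (norm (0::'a))\<^sup>2 + (norm (0::'a))\<^sup>2"
    by (intro tendsto_intros orbit_limit)
  ultimately have "(norm g)\<^sup>2 + (norm h)\<^sup>2 = 0"
    by (simp add: LIMSEQ_const_iff)
  then show ?thesis
    by (simp add: add_nonneg_eq_0_iff)
qed

text \<open>Before time \<open>N\<close> the trajectory differs from the steady sinusoid by the
  transient \<open>(A ^^ t) g\<close>; from \<open>N\<close> on it is a free orbit with a bounded
  start. Both contributions are summable with bounds that do not involve \<open>N\<close>.\<close>

lemma truncated_harmonic_cost:
  assumes harm: "harmonic \<theta> g h v w"
  obtains c where "\<And>N. quadratic_cost 0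
      (\<lambda>t. if t < N then cos (real t * \<theta>) *\<^sub>R v - sin (real t * \<theta>) *\<^sub>R w else 0)
    \<le> (\<Sum>t<N. form (cos (real t * \<theta>) *\<^sub>R (g, v) - sin (real t * \<theta>) *\<^sub>R (h, w))) + c"
proof -
  obtain \<kappa> where \<kappa>: "\<kappa> > 0" "\<And>x. summable (\<lambda>k. norm ((A ^^ k) x))"
    "\<And>x. (\<Sum>k. norm ((A ^^ k) x)) \<le> \<kappa> * norm x"
    "\<And>x n. (\<Sum>k<n. norm ((A ^^ k) x)) \<le> \<kappa> * norm x"
    "\<And>x k. norm ((A ^^ k) x) \<le> \<kappa> * norm x"
    using orbit_bounds by metis
  define p where "p t = cos (real t * \<theta>) *\<^sub>R (g, v) - sin (real t * \<theta>) *\<^sub>R (h, w)" for t :: nat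
  define c0 where "c0 = norm (g, v) + norm (h, w)"
  have p_le: "norm (p t) \<le> c0" for t
  proof -
    have "norm (p t) \<le> \<bar>cos (real t * \<theta>)\<bar> * norm (g, v) + \<bar>sin (real t * \<theta>)\<bar> * norm (h, w)"
      unfolding p_def by (metis norm_scaleR norm_triangle_ineq4)
    also have "\<dots> \<le> 1 * norm (g, v) + 1 * norm (h, w)"
      by (intro add_mono mult_right_mono) auto
    finally show ?thesis by (simp add: c0_def)
  qed
  define c1 where "c1 = c0 + \<kappa> * norm g"
  have c0: "c0 \<ge> 0" and c1: "c1 \<ge> 0" "c0 \<le> c1"
    using \<kappa>(1) by (simp_all add: c0_def c1_def)
  have fst_p_le: "norm (fst (p t)) \<le> c0" for t
    using norm_fst_le[of "fst (p t)" "snd (p t)"] p_le[of t] by simp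
  \<comment> \<open>The first summand pays for the transient before time \<open>N\<close>, the
    second for the free motion afterwards; \<open>c1\<close> bounds the state at time
    \<open>N\<close>.\<close>
  define c where "c = S_bound * (2 * c0 + \<kappa> * norm g) * (\<kappa> * norm g)
    + S_bound * (\<kappa> * c1) * (\<kappa> * c1)"
  have "quadratic_cost 0 (\<lambda>t. if t < N then cos (real t * \<theta>) *\<^sub>R v - sin (real t * \<theta>) *\<^sub>R w else 0)
      \<le> (\<Sum>t<N. form (p t)) + c" for N
  proof -
    define u where "u t = (if t < N then cos (real t * \<theta>) *\<^sub>R v - sin (real t * \<theta>) *\<^sub>R w else 0)" for t :: nat
    let ?y = "trajectory 0 u"
    have y: "?y t = fst (p t) - (A ^^ t) g" if "t \<le> N" for t
      using harmonic_trajectory[OF harm, of N u t] that by (simp add: u_def p_def)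
    have summ_u: "summable (\<lambda>t. (norm (u t))\<^sup>2)"
      by (rule summable_finite[of "{..<N}"]) (auto simp: u_def)
    have "form (?y t, u t) \<le> form (p t) + S_bound * (2 * c0 + \<kappa> * norm g) * norm ((A ^^ t) g)"
      if "t < N" for t
    proof -
      let ?n = "norm ((A ^^ t) g)"
      have eq: "(?y t, u t) = p t + (- (A ^^ t) g, 0)"
        using that y[of t] by (simp add: p_def u_def)
      have "form (?y t, u t) \<le> form (p t) + S_bound * (2 * norm (p t) * ?n + ?n\<^sup>2)"
        using form_perturb[of "p t" "(- (A ^^ t) g, 0)"] unfolding eq by (simp add: norm_Pair)
      \<comment> \<open>One factor of the squared transient is replaced by its uniform bound. The
        error becomes linear in the orbit norm, whose sum is at most
        \<open>\<kappa> * norm g\<close>.\<close>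
      also have "2 * norm (p t) * ?n + ?n\<^sup>2 \<le> 2 * c0 * ?n + (\<kappa> * norm g) * ?n"
        unfolding power2_eq_square using p_le \<kappa>(5)
        by (intro add_mono mult_right_mono) auto
      finally show ?thesis
        using S_bound(1) by (simp add: algebra_simps)
    qed
    then have "(\<Sum>t<N. form (?y t, u t))
        \<le> (\<Sum>t<N. form (p t) + S_bound * (2 * c0 + \<kappa> * norm g) * norm ((A ^^ t) g))"
      by (intro sum_mono) auto
    also have "\<dots> = (\<Sum>t<N. form (p t))
        + S_bound * (2 * c0 + \<kappa> * norm g) * (\<Sum>t<N. norm ((A ^^ t) g))"
      by (simp add: sum.distrib sum_distrib_left)
    also have "\<dots> \<le> (\<Sum>t<N. form (p t)) + S_bound * (2 * c0 + \<kappa> * norm g) * (\<kappa> * norm g)"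
      using S_bound(1) c0 \<kappa>(1) by (intro add_left_mono mult_left_mono \<kappa>(4)) auto
    finally have head: "(\<Sum>t<N. form (?y t, u t))
      \<le> (\<Sum>t<N. form (p t)) + S_bound * (2 * c0 + \<kappa> * norm g) * (\<kappa> * norm g)" .
    have "norm (?y N) \<le> norm (fst (p N)) + norm ((A ^^ N) g)"
      unfolding y[OF order_refl] by (rule norm_triangle_ineq4)
    also have "\<dots> \<le> c1"
      unfolding c1_def by (intro add_mono fst_p_le \<kappa>(5))
    finally have yN: "norm (?y N) \<le> c1" .
    \<comment> \<open>The same device as for the transient: one factor of the square is bounded
      uniformly, the other is left to be summed.\<close>
    have tail_le: "form (?y (k + N), u (k + N)) \<le> S_bound * (\<kappa> * c1) * norm ((A ^^ k) (?y N))" for k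
    proof -
      let ?n = "norm ((A ^^ k) (?y N))"
      have "form (?y (k + N), u (k + N)) \<le> S_bound * ?n\<^sup>2"
        using abs_form_le[of "(?y (k + N), u (k + N))"]
        by (simp add: trajectory_free u_def norm_Pair)
      also have "?n \<le> \<kappa> * c1"
        using \<kappa>(5)[of k "?y N"] mult_left_mono[OF yN, of \<kappa>] \<kappa>(1) by linarith
      then have "S_bound * ?n\<^sup>2 \<le> S_bound * ((\<kappa> * c1) * ?n)"
        unfolding power2_eq_square using S_bound(1) by (intro mult_left_mono mult_right_mono) auto
      finally show ?thesis by (simp add: mult_ac)
    qed
    have "(\<Sum>k. form (?y (k + N), u (k + N)))
        \<le> (\<Sum>k. S_bound * (\<kappa> * c1) * norm ((A ^^ k) (?y N)))"
      by (intro suminf_le tail_le summable_mult \<kappa>(2)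
          summable_ignore_initial_segment[OF summable_form[OF summ_u]])
    also have "\<dots> = S_bound * (\<kappa> * c1) * (\<Sum>k. norm ((A ^^ k) (?y N)))"
      by (intro suminf_mult \<kappa>(2))
    also have "\<dots> \<le> S_bound * (\<kappa> * c1) * (\<kappa> * c1)"
    proof (rule mult_left_mono)
      show "(\<Sum>k. norm ((A ^^ k) (?y N))) \<le> \<kappa> * c1"
        using \<kappa>(3)[of "?y N"] mult_left_mono[OF yN, of \<kappa>] \<kappa>(1) by linarith
    qed (use \<kappa>(1) S_bound(1) c1(1) in simp)
    finally have tail: "(\<Sum>k. form (?y (k + N), u (k + N))) \<le> S_bound * (\<kappa> * c1) * (\<kappa> * c1)" .
    have "quadratic_cost 0 u = (\<Sum>k. form (?y (k + N), u (k + N))) + (\<Sum>t<N. form (?y t, u t))"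
      unfolding quadratic_cost_def by (rule suminf_split_initial_segment[OF summable_form[OF summ_u]])
    then have "quadratic_cost 0 u \<le> (\<Sum>t<N. form (p t)) + c"
      using head tail by (simp add: c_def)
    moreover have "u = (\<lambda>t. if t < N then cos (real t * \<theta>) *\<^sub>R v - sin (real t * \<theta>) *\<^sub>R w else 0)"
      by (simp add: u_def fun_eq_iff)
    ultimately show ?thesis by simp
  qed
  then show thesis
    unfolding p_def by (rule that)
qed

text \<open>The sinusoid and its quarter-period shift are used together: by
  \<open>form_rotate\<close> their stage costs add up to a constant. Hence \<open>N\<close> times
  this constant plus a fixed error is nonnegative for every \<open>N\<close>, which rules out a
  negative constant.\<close>

lemma frequency_nonneg:
  assumes cost: "\<And>u. summable (\<lambda>t. (norm (u t))\<^sup>2) \<Longrightarrow> 0 \<le> quadratic_cost 0 u"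
    and harm: "harmonic \<theta> g h v w"
  shows "0 \<le> form (g, v) + form (h, w)"
proof -
  note harm' = harmonic_swap[OF harm]
  obtain c where c: "\<And>N. quadratic_cost 0
      (\<lambda>t. if t < N then cos (real t * \<theta>) *\<^sub>R v - sin (real t * \<theta>) *\<^sub>R w else 0)
    \<le> (\<Sum>t<N. form (cos (real t * \<theta>) *\<^sub>R (g, v) - sin (real t * \<theta>) *\<^sub>R (h, w))) + c"
    using truncated_harmonic_cost[OF harm] by blast
  obtain c' where c': "\<And>N. quadratic_cost 0
      (\<lambda>t. if t < N then cos (real t * \<theta>) *\<^sub>R w - sin (real t * \<theta>) *\<^sub>R (- v) else 0)
    \<le> (\<Sum>t<N. form (cos (real t * \<theta>) *\<^sub>R (h, w) - sin (real t * \<theta>) *\<^sub>R (- g, - v))) + c'"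
    using truncated_harmonic_cost[OF harm'] by blast
  have bound: "0 \<le> real N * (form (g, v) + form (h, w)) + (c + c')" for N
  proof -
    have fin: "summable (\<lambda>t. (norm (if t < N then f t else (0::'b)))\<^sup>2)" for f
      by (rule summable_finite[of "{..<N}"]) auto
    have "0 \<le> (\<Sum>t<N. form (cos (real t * \<theta>) *\<^sub>R (g, v) - sin (real t * \<theta>) *\<^sub>R (h, w))) + c
      + ((\<Sum>t<N. form (cos (real t * \<theta>) *\<^sub>R (h, w) - sin (real t * \<theta>) *\<^sub>R (- g, - v))) + c')"
      using order_trans[OF cost[OF fin] c[of N]] order_trans[OF cost[OF fin] c'[of N]]
      by (rule add_nonneg_nonneg)
    \<comment> \<open>The double minus signs from \<open>harmonic_swap\<close> turn the shifted
      sinusoid into the second vector of \<open>form_rotate\<close>.\<close>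
    also have "\<dots> = (\<Sum>t<N. form (cos (real t * \<theta>) *\<^sub>R (g, v) - sin (real t * \<theta>) *\<^sub>R (h, w))
        + form (sin (real t * \<theta>) *\<^sub>R (g, v) + cos (real t * \<theta>) *\<^sub>R (h, w))) + (c + c')"
      by (simp add: sum.distrib add.commute)
    finally show ?thesis
      unfolding form_rotate by simp
  qed
  show ?thesis
  proof (rule ccontr)
    assume "\<not> ?thesis"
    then have "0 < - (form (g, v) + form (h, w))" by simp
    then obtain N :: nat where "c + c' < N * - (form (g, v) + form (h, w))"
      using reals_Archimedean3 by blast
    then show False using bound[of N] by linarith
  qed
qed

end

section \<open>Finite Fourier analysis at the roots of unity\<close>

text \<open>Orthogonality of the characters of the cyclic group of order \<open>M\<close>: off the
  diagonal the sum is the real part of a geometric sum over an \<open>M\<close>-th root of unity.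
  That root is not 1, because \<open>s - t\<close> is nonzero and smaller than \<open>M\<close> in
  absolute value.\<close>

lemma sum_cos_roots_of_unity:
  fixes s t M :: nat
  assumes "s < M" "t < M"
  shows "(\<Sum>k<M. cos (real s * (2 * pi * real k / real M) - real t * (2 * pi * real k / real M))) = (if s = t then M else 0)"
proof (cases "s = t")
  case False
  define j where "j = real s - real t"
  define z where "z = cis (2 * pi * j / M)"
  have "z ^ M = 1"
    unfolding z_def Complex.DeMoivre using assms by (simp add: cis_multiple_2pi j_def)
  have "z \<noteq> 1"
  proof
    assume "z = 1"
    then have "cos (2 * pi * j / M) = 1"
      by (metis z_def cis.simps(1) one_complex.simps(1))
    then obtain n :: int where "2 * pi * j / M = real_of_int n * 2 * pi"
      unfolding cos_one_2pi_int by blast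
    then have j: "j = n * real M"
      using assms by (simp add: field_simps)
    have "j \<noteq> 0" "\<bar>j\<bar> < real M"
      using False assms by (auto simp: j_def)
    then have "n \<noteq> 0" "\<bar>real_of_int n\<bar> * real M < 1 * real M"
      using j by (auto simp: abs_mult)
    then have "\<bar>real_of_int n\<bar> < 1" "n \<noteq> 0"
      using assms by (auto simp: mult_less_cancel_right)
    then show False by linarith
  qed
  have "(\<Sum>k<M. cos (real s * (2 * pi * real k / real M) - real t * (2 * pi * real k / real M))) = (\<Sum>k<M. Re (z ^ k))"
    unfolding z_def Complex.DeMoivre by (intro sum.cong refl) (simp add: j_def field_simps)
  also have "\<dots> = Re (\<Sum>k<M. z ^ k)"
    by simp
  also have "(\<Sum>k<M. z ^ k) = 0"
    using \<open>z ^ M = 1\<close> \<open>z \<noteq> 1\<close> by (simp add: geometric_sum)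
  finally show ?thesis using False by simp
qed simp

text \<open>The two inner sums are the real and imaginary parts of the transform
  \<open>\<Sum>t<M. exp (- i t \<theta>) p t\<close> at the frequency with index \<open>k\<close>.
  Expanding both quadratic forms combines the products into
  \<open>cos (s \<theta> - t \<theta>)\<close>, so orthogonality applies even to an operator without
  symmetry.\<close>

lemma discrete_parseval:
  fixes p :: "nat \<Rightarrow> 'c::real_inner"
  assumes "linear T"
  shows "(\<Sum>k<M. (\<Sum>t<M. cos (real t * (2 * pi * real k / real M)) *\<^sub>R p t) \<bullet> T (\<Sum>t<M. cos (real t * (2 * pi * real k / real M)) *\<^sub>R p t)
      + (\<Sum>t<M. - sin (real t * (2 * pi * real k / real M)) *\<^sub>R p t) \<bullet> T (\<Sum>t<M. - sin (real t * (2 * pi * real k / real M)) *\<^sub>R p t))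
    = M * (\<Sum>t<M. p t \<bullet> T (p t))"
proof -
  interpret T: linear T by fact
  have expand: "(\<Sum>t<M. f t *\<^sub>R p t) \<bullet> T (\<Sum>t<M. f t *\<^sub>R p t)
      = (\<Sum>s<M. \<Sum>t<M. f s * f t * (p s \<bullet> T (p t)))" for f :: "nat \<Rightarrow> real"
    unfolding T.sum T.scale inner_sum_left inner_sum_right
    by (subst sum.swap) (simp add: mult_ac)
  let ?\<theta> = "\<lambda>k. 2 * pi * real k / real M"
  have "(\<Sum>k<M. (\<Sum>t<M. cos (real t * ?\<theta> k) *\<^sub>R p t) \<bullet> T (\<Sum>t<M. cos (real t * ?\<theta> k) *\<^sub>R p t)
      + (\<Sum>t<M. - sin (real t * ?\<theta> k) *\<^sub>R p t) \<bullet> T (\<Sum>t<M. - sin (real t * ?\<theta> k) *\<^sub>R p t))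
    = (\<Sum>k<M. \<Sum>s<M. \<Sum>t<M. cos (real s * ?\<theta> k - real t * ?\<theta> k) * (p s \<bullet> T (p t)))"
    unfolding expand by (simp add: cos_diff distrib_right flip: sum.distrib)
  also have "\<dots> = (\<Sum>s<M. \<Sum>k<M. \<Sum>t<M. cos (real s * ?\<theta> k - real t * ?\<theta> k) * (p s \<bullet> T (p t)))"
    by (rule sum.swap)
  also have "\<dots> = (\<Sum>s<M. \<Sum>t<M. \<Sum>k<M. cos (real s * ?\<theta> k - real t * ?\<theta> k) * (p s \<bullet> T (p t)))"
    by (intro sum.cong refl sum.swap)
  also have "\<dots> = (\<Sum>s<M. \<Sum>t<M. (if s = t then M else 0) * (p s \<bullet> T (p t)))"
    by (intro sum.cong refl) (simp only: sum_distrib_right[symmetric] sum_cos_roots_of_unity lessThan_iff)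
  also have "\<dots> = (\<Sum>s<M. M * (p s \<bullet> T (p s)))"
    by (intro sum.cong refl) (simp add: if_distrib[of real] if_distrib[of "\<lambda>x. x * _"] cong: if_cong)
  finally show ?thesis by (simp add: sum_distrib_left)
qed

context stable_linear_system
begin

text \<open>The witness is \<open>h1 + i h2 = (\<Sum>k. exp (- i k \<theta>) A\<^sup>k x)\<close>.\<close>

lemma orbit_transform:
  obtains \<kappa> where "\<kappa> > 0" "\<And>\<theta> x. \<exists>h1 h2. norm h1 \<le> \<kappa> * norm x \<and> norm h2 \<le> \<kappa> * norm x \<and>
      cos \<theta> *\<^sub>R h1 - sin \<theta> *\<^sub>R h2 = A h1 + cos \<theta> *\<^sub>R x \<and>
      sin \<theta> *\<^sub>R h1 + cos \<theta> *\<^sub>R h2 = A h2 + sin \<theta> *\<^sub>R x"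
proof -
  obtain \<kappa> where \<kappa>: "\<kappa> > 0" "\<And>x. summable (\<lambda>k. norm ((A ^^ k) x))"
    "\<And>x. (\<Sum>k. norm ((A ^^ k) x)) \<le> \<kappa> * norm x"
    using orbit_bounds by metis
  have "\<exists>h1 h2. norm h1 \<le> \<kappa> * norm x \<and> norm h2 \<le> \<kappa> * norm x \<and>
      cos \<theta> *\<^sub>R h1 - sin \<theta> *\<^sub>R h2 = A h1 + cos \<theta> *\<^sub>R x \<and>
      sin \<theta> *\<^sub>R h1 + cos \<theta> *\<^sub>R h2 = A h2 + sin \<theta> *\<^sub>R x" for \<theta> x
  proof -
    have summ: "summable (\<lambda>k. norm (f k *\<^sub>R (A ^^ k) x))" if "\<And>k. \<bar>f k\<bar> \<le> 1" for f :: "nat \<Rightarrow> real"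
      by (rule summable_comparison_test'[where N = 0, OF \<kappa>(2)[of x]])
        (simp add: mult_left_le_one_le that)
    have bound: "norm (\<Sum>k. f k *\<^sub>R (A ^^ k) x) \<le> \<kappa> * norm x" if "\<And>k. \<bar>f k\<bar> \<le> 1" for f :: "nat \<Rightarrow> real"
    proof -
      have "norm (\<Sum>k. f k *\<^sub>R (A ^^ k) x) \<le> (\<Sum>k. norm (f k *\<^sub>R (A ^^ k) x))"
        by (intro summable_norm summ that)
      also have "\<dots> \<le> (\<Sum>k. norm ((A ^^ k) x))"
        by (intro suminf_le summ \<kappa>(2) that) (simp add: mult_left_le_one_le that)
      finally show ?thesis using \<kappa>(3)[of x] by linarith
    qed
    have step: "(\<Sum>k. f k *\<^sub>R (A ^^ k) x) = A (\<Sum>k. f (Suc k) *\<^sub>R (A ^^ k) x) + f 0 *\<^sub>R x"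
      if f: "\<And>k. \<bar>f k\<bar> \<le> 1" for f :: "nat \<Rightarrow> real"
    proof -
      have "A (\<Sum>k. f (Suc k) *\<^sub>R (A ^^ k) x) = (\<Sum>k. A (f (Suc k) *\<^sub>R (A ^^ k) x))"
        by (rule bounded_linear.suminf[OF linear_conv_bounded_linear[THEN iffD1, OF linear_A]])
          (rule summable_norm_cancel[OF summ], rule f)
      also have "\<dots> = (\<Sum>k. f (Suc k) *\<^sub>R (A ^^ Suc k) x)"
        by (simp add: A.scale)
      finally show ?thesis
        using suminf_split_head[OF summable_norm_cancel[OF summ[of f]]] f by simp
    qed
    have comb: "c *\<^sub>R (\<Sum>k. f k *\<^sub>R (A ^^ k) x) + d *\<^sub>R (\<Sum>k. f' k *\<^sub>R (A ^^ k) x)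
        = (\<Sum>k. (c * f k + d * f' k) *\<^sub>R (A ^^ k) x)"
      if "\<And>k. \<bar>f k\<bar> \<le> 1" "\<And>k. \<bar>f' k\<bar> \<le> 1" for f f' :: "nat \<Rightarrow> real" and c d
    proof -
      have f: "summable (\<lambda>k. f k *\<^sub>R (A ^^ k) x)" and f': "summable (\<lambda>k. f' k *\<^sub>R (A ^^ k) x)"
        using summ that by (auto intro: summable_norm_cancel)
      show ?thesis
        unfolding suminf_scaleR_right[OF f] suminf_scaleR_right[OF f']
          suminf_add[OF summable_scaleR_right[OF f] summable_scaleR_right[OF f']]
        by (simp add: scaleR_add_left)
    qed
    define h1 where "h1 = (\<Sum>k. cos (real k * \<theta>) *\<^sub>R (A ^^ k) x)"
    define h2 where "h2 = (\<Sum>k. (- sin (real k * \<theta>)) *\<^sub>R (A ^^ k) x)"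
    have "cos \<theta> *\<^sub>R h1 - sin \<theta> *\<^sub>R h2 = (\<Sum>k. cos (\<theta> - real k * \<theta>) *\<^sub>R (A ^^ k) x)"
      unfolding h1_def h2_def
      using comb[of "\<lambda>k. cos (real k * \<theta>)" "\<lambda>k. - sin (real k * \<theta>)" "cos \<theta>" "- sin \<theta>"]
      by (simp add: cos_diff)
    also have "\<dots> = A h1 + cos \<theta> *\<^sub>R x"
      using step[of "\<lambda>k. cos (\<theta> - real k * \<theta>)"] by (simp add: h1_def algebra_simps)
    finally have 1: "cos \<theta> *\<^sub>R h1 - sin \<theta> *\<^sub>R h2 = A h1 + cos \<theta> *\<^sub>R x" .
    have "sin \<theta> *\<^sub>R h1 + cos \<theta> *\<^sub>R h2 = (\<Sum>k. sin (\<theta> - real k * \<theta>) *\<^sub>R (A ^^ k) x)"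
      unfolding h1_def h2_def
      using comb[of "\<lambda>k. cos (real k * \<theta>)" "\<lambda>k. - sin (real k * \<theta>)" "sin \<theta>" "cos \<theta>"]
      by (simp add: sin_diff)
    also have "\<dots> = A h2 + sin \<theta> *\<^sub>R x"
      using step[of "\<lambda>k. sin (\<theta> - real k * \<theta>)"] by (simp add: h2_def algebra_simps)
    finally have 2: "sin \<theta> *\<^sub>R h1 + cos \<theta> *\<^sub>R h2 = A h2 + sin \<theta> *\<^sub>R x" .
    show ?thesis
      using 1 2 bound[of "\<lambda>k. cos (real k * \<theta>)"] bound[of "\<lambda>k. - sin (real k * \<theta>)"]
      unfolding h1_def[symmetric] h2_def[symmetric] by auto
  qed
  with \<kappa>(1) show thesis using that by blast
qed

text \<open>Real and imaginary parts of the shift rule: multiplying the transform by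
  \<open>exp (i \<theta>)\<close> moves the index by one step of the recursion. The boundary term at
  time 0 vanishes with the initial state; the one at time \<open>M\<close> remains.\<close>

lemma trajectory_transform:
  fixes \<theta> :: real and u :: "nat \<Rightarrow> 'b"
  defines "y \<equiv> trajectory 0 u"
  shows "(\<Sum>t<M. cos (\<theta> - real t * \<theta>) *\<^sub>R y t) = A (\<Sum>t<M. cos (real t * \<theta>) *\<^sub>R y t)
      + B (\<Sum>t<M. cos (real t * \<theta>) *\<^sub>R u t) - cos (\<theta> - real M * \<theta>) *\<^sub>R y M" (is ?thesis1)
    and "(\<Sum>t<M. sin (\<theta> - real t * \<theta>) *\<^sub>R y t) = A (\<Sum>t<M. - sin (real t * \<theta>) *\<^sub>R y t)
      + B (\<Sum>t<M. - sin (real t * \<theta>) *\<^sub>R u t) - sin (\<theta> - real M * \<theta>) *\<^sub>R y M" (is ?thesis2)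
proof -
  have "cos (\<theta> - (1 + real M) * \<theta>) = cos (real M * \<theta>)" "sin (\<theta> - (1 + real M) * \<theta>) = - sin (real M * \<theta>)" for M
    by (simp_all add: algebra_simps)
  note shift = this
  show ?thesis1
    by (induction M) (simp_all add: y_def A.zero B.zero A.add B.add A.scale B.scale shift scaleR_add_right)
  show ?thesis2
    by (induction M) (simp_all add: y_def A.zero B.zero A.add B.add A.diff B.diff A.scale B.scale shift scaleR_add_right)
qed

text \<open>The discrete Fourier transform of the trajectory truncated at time \<open>M\<close>, taken at the \<open>M\<close>-th roots
  of unity, satisfies the harmonic equation up to an error of the size of the state at time \<open>M\<close>,
  which tends to \<open>0\<close>.\<close>

lemma coercive_cost:
  assumes coercive: "\<And>\<theta> g h v w. harmonic \<theta> g h v w \<Longrightarrow>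
      \<delta> * ((norm v)\<^sup>2 + (norm w)\<^sup>2) \<le> form (g, v) + form (h, w)"
    and u: "summable (\<lambda>t. (norm (u t))\<^sup>2)"
  shows "\<delta> * (\<Sum>t. (norm (u t))\<^sup>2) \<le> quadratic_cost 0 u"
proof -
  obtain \<kappa> where \<kappa>: "\<kappa> > 0" and orbit: "\<And>\<theta> x. \<exists>h1 h2. norm h1 \<le> \<kappa> * norm x \<and> norm h2 \<le> \<kappa> * norm x \<and>
      cos \<theta> *\<^sub>R h1 - sin \<theta> *\<^sub>R h2 = A h1 + cos \<theta> *\<^sub>R x \<and>
      sin \<theta> *\<^sub>R h1 + cos \<theta> *\<^sub>R h2 = A h2 + sin \<theta> *\<^sub>R x"
    using orbit_transform by blast
  define y where "y = trajectory 0 u"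
  define p where "p t = (y t, u t)" for t
  define c where "c M = \<kappa> * norm (y M)" for M
  have c_nonneg: "c M \<ge> 0" for M
    using \<kappa> by (simp add: c_def)
  have main: "\<delta> * (\<Sum>t<M. (norm (u t))\<^sup>2) \<le> (\<Sum>t<M. form (p t))
      + S_bound * (c M * ((\<Sum>t<M. (norm (p t))\<^sup>2) + 2) + 2 * (c M)\<^sup>2)" if "M > 0" for M
  proof -
    define \<theta> where "\<theta> k = 2 * pi * real k / real M" for k
    define y1 where "y1 k = (\<Sum>t<M. cos (real t * \<theta> k) *\<^sub>R y t)" for k
    define y2 where "y2 k = (\<Sum>t<M. - sin (real t * \<theta> k) *\<^sub>R y t)" for k
    define d1 where "d1 k = (\<Sum>t<M. cos (real t * \<theta> k) *\<^sub>R u t)" for k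
    define d2 where "d2 k = (\<Sum>t<M. - sin (real t * \<theta> k) *\<^sub>R u t)" for k
    have p1: "(\<Sum>t<M. cos (real t * \<theta> k) *\<^sub>R p t) = (y1 k, d1 k)" for k
      by (rule prod_eqI) (simp_all add: y1_def d1_def p_def fst_sum snd_sum)
    have p2: "(\<Sum>t<M. - sin (real t * \<theta> k) *\<^sub>R p t) = (y2 k, d2 k)" for k
      by (rule prod_eqI) (simp_all add: y2_def d2_def p_def fst_sum snd_sum)
    \<comment> \<open>The cross term is split by \<open>2 * r \<le> r\<^sup>2 + 1\<close>, so that
      the error contains only squared norms, which Parseval can sum over the frequencies.\<close>
    have perturb: "form (x + h, v) \<le> form (x, v) + S_bound * (c M * ((norm (x, v))\<^sup>2 + 1) + (c M)\<^sup>2)"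
      if h: "norm h \<le> c M" for x h v
    proof -
      have "form (x + h, v) \<le> form (x, v) + S_bound * (2 * norm (x, v) * norm h + (norm h)\<^sup>2)"
        using form_perturb[of "(x, v)" "(h, 0)"] by (simp add: norm_Pair)
      also have "2 * norm (x, v) * norm h + (norm h)\<^sup>2 \<le> c M * ((norm (x, v))\<^sup>2 + 1) + (c M)\<^sup>2"
      proof (intro add_mono power_mono h)
        have "2 * norm (x, v) * norm h \<le> ((norm (x, v))\<^sup>2 + 1) * norm h"
          using sum_squares_bound[of "norm (x, v)" 1] by (intro mult_right_mono) auto
        also have "\<dots> \<le> ((norm (x, v))\<^sup>2 + 1) * c M"
          using h by (intro mult_left_mono) auto
        finally show "2 * norm (x, v) * norm h \<le> c M * ((norm (x, v))\<^sup>2 + 1)"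
          by (simp add: mult.commute)
      qed auto
      finally show ?thesis
        using S_bound(1) by simp
    qed
    have each: "\<delta> * ((norm (d1 k))\<^sup>2 + (norm (d2 k))\<^sup>2) \<le> form (y1 k, d1 k) + form (y2 k, d2 k)
        + S_bound * c M * ((norm (y1 k, d1 k))\<^sup>2 + (norm (y2 k, d2 k))\<^sup>2)
        + S_bound * (2 * c M + 2 * (c M)\<^sup>2)" for k
    proof -
      obtain h1 h2 where h: "norm h1 \<le> c M" "norm h2 \<le> c M"
        "cos (\<theta> k) *\<^sub>R h1 - sin (\<theta> k) *\<^sub>R h2 = A h1 + cos (\<theta> k) *\<^sub>R y M"
        "sin (\<theta> k) *\<^sub>R h1 + cos (\<theta> k) *\<^sub>R h2 = A h2 + sin (\<theta> k) *\<^sub>R y M"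
        using orbit[of "y M" "\<theta> k"] unfolding c_def by blast
      \<comment> \<open>At an \<open>M\<close>-th root of unity the phase of the boundary term loses
        its dependence on \<open>M\<close> and matches the inhomogeneity solved by
        \<open>orbit_transform\<close>.\<close>
      have "real M * \<theta> k = 2 * real k * pi"
        using \<open>M > 0\<close> by (simp add: \<theta>_def)
      then have period: "cos (\<theta> k - real M * \<theta> k) = cos (\<theta> k)" "sin (\<theta> k - real M * \<theta> k) = sin (\<theta> k)"
        by (simp_all add: cos_diff sin_diff cos_2npi sin_2npi del: of_nat_mult)
      have "cos (\<theta> k) *\<^sub>R y1 k - sin (\<theta> k) *\<^sub>R y2 k = (\<Sum>t<M. cos (\<theta> k - real t * \<theta> k) *\<^sub>R y t)"
        by (simp add: y1_def y2_def scaleR_sum_right cos_diff scaleR_add_left sum.distrib sum_negf)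
      then have t1: "cos (\<theta> k) *\<^sub>R y1 k - sin (\<theta> k) *\<^sub>R y2 k = A (y1 k) + B (d1 k) - cos (\<theta> k) *\<^sub>R y M"
        using trajectory_transform(1)[where \<theta> = "\<theta> k" and u = u and M = M] unfolding period
        by (simp add: y_def y1_def d1_def)
      have "sin (\<theta> k) *\<^sub>R y1 k + cos (\<theta> k) *\<^sub>R y2 k = (\<Sum>t<M. sin (\<theta> k - real t * \<theta> k) *\<^sub>R y t)"
        by (simp add: y1_def y2_def scaleR_sum_right sin_diff scaleR_diff_left sum_subtractf sum_negf)
      then have t2: "sin (\<theta> k) *\<^sub>R y1 k + cos (\<theta> k) *\<^sub>R y2 k = A (y2 k) + B (d2 k) - sin (\<theta> k) *\<^sub>R y M"
        using trajectory_transform(2)[where \<theta> = "\<theta> k" and u = u and M = M] unfolding period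
        by (simp add: y_def y2_def d2_def)
      \<comment> \<open>The correction \<open>h1 + i h2\<close> cancels the boundary term exactly,
        so the coercivity hypothesis applies to the corrected transform.\<close>
      have "harmonic (\<theta> k) (y1 k + h1) (y2 k + h2) (d1 k) (d2 k)"
        unfolding harmonic_def
      proof
        have "cos (\<theta> k) *\<^sub>R (y1 k + h1) - sin (\<theta> k) *\<^sub>R (y2 k + h2)
          = (cos (\<theta> k) *\<^sub>R y1 k - sin (\<theta> k) *\<^sub>R y2 k) + (cos (\<theta> k) *\<^sub>R h1 - sin (\<theta> k) *\<^sub>R h2)"
          by (simp add: algebra_simps)
        then show "cos (\<theta> k) *\<^sub>R (y1 k + h1) - sin (\<theta> k) *\<^sub>R (y2 k + h2) = A (y1 k + h1) + B (d1 k)"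
          unfolding t1 h(3) by (simp add: A.add)
        have "sin (\<theta> k) *\<^sub>R (y1 k + h1) + cos (\<theta> k) *\<^sub>R (y2 k + h2)
          = (sin (\<theta> k) *\<^sub>R y1 k + cos (\<theta> k) *\<^sub>R y2 k) + (sin (\<theta> k) *\<^sub>R h1 + cos (\<theta> k) *\<^sub>R h2)"
          by (simp add: algebra_simps)
        then show "sin (\<theta> k) *\<^sub>R (y1 k + h1) + cos (\<theta> k) *\<^sub>R (y2 k + h2) = A (y2 k + h2) + B (d2 k)"
          unfolding t2 h(4) by (simp add: A.add)
      qed
      from coercive[OF this] perturb[OF h(1), of "y1 k" "d1 k"] perturb[OF h(2), of "y2 k" "d2 k"]
      show ?thesis
        by (simp add: algebra_simps)
    qed
    have parseval_form: "(\<Sum>k<M. form (y1 k, d1 k) + form (y2 k, d2 k)) = M * (\<Sum>t<M. form (p t))"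
      using discrete_parseval[OF linear_S, of M p]
      unfolding \<theta>_def[symmetric] p1 p2 form_def .
    have parseval_p: "(\<Sum>k<M. (norm (y1 k, d1 k))\<^sup>2 + (norm (y2 k, d2 k))\<^sup>2) = M * (\<Sum>t<M. (norm (p t))\<^sup>2)"
      using discrete_parseval[OF linear_ident, of M p]
      unfolding \<theta>_def[symmetric] p1 p2 power2_norm_eq_inner .
    have parseval_u: "(\<Sum>k<M. (norm (d1 k))\<^sup>2 + (norm (d2 k))\<^sup>2) = M * (\<Sum>t<M. (norm (u t))\<^sup>2)"
      using discrete_parseval[OF linear_ident, of M u]
      unfolding \<theta>_def[symmetric] d1_def[symmetric] d2_def[symmetric] power2_norm_eq_inner .
    have "\<delta> * (\<Sum>k<M. (norm (d1 k))\<^sup>2 + (norm (d2 k))\<^sup>2)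
      \<le> (\<Sum>k<M. form (y1 k, d1 k) + form (y2 k, d2 k)
        + S_bound * c M * ((norm (y1 k, d1 k))\<^sup>2 + (norm (y2 k, d2 k))\<^sup>2)
        + S_bound * (2 * c M + 2 * (c M)\<^sup>2))"
      unfolding sum_distrib_left by (intro sum_mono each)
    also have "\<dots> = (\<Sum>k<M. form (y1 k, d1 k) + form (y2 k, d2 k))
        + S_bound * c M * (\<Sum>k<M. (norm (y1 k, d1 k))\<^sup>2 + (norm (y2 k, d2 k))\<^sup>2)
        + M * (S_bound * (2 * c M + 2 * (c M)\<^sup>2))"
      unfolding sum_distrib_left sum.distrib[of _ "\<lambda>_. S_bound * (2 * c M + 2 * (c M)\<^sup>2)"]
        sum.distrib[of "\<lambda>k. form (y1 k, d1 k) + form (y2 k, d2 k)"] by simp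
    \<comment> \<open>Every Parseval sum carries the factor \<open>M\<close>, as does the sum of the
      constant errors, so \<open>M\<close> cancels. What remains of the error is \<open>c M\<close>
      times bounded quantities.\<close>
    finally have "M * (\<delta> * (\<Sum>t<M. (norm (u t))\<^sup>2)) \<le> M * ((\<Sum>t<M. form (p t))
      + S_bound * (c M * ((\<Sum>t<M. (norm (p t))\<^sup>2) + 2) + 2 * (c M)\<^sup>2))"
      unfolding parseval_form parseval_p parseval_u by (simp add: algebra_simps)
    then show ?thesis
      using \<open>M > 0\<close> by (simp only: mult_le_cancel_left_pos of_nat_0_less_iff)
  qed
  have summ_p: "summable (\<lambda>t. (norm (p t))\<^sup>2)"
    unfolding p_def y_def by (rule summable_norm_pair[OF u])
  have "(\<lambda>t. sqrt ((norm (y t))\<^sup>2)) \<longlonglongrightarrow> sqrt 0"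
    unfolding y_def by (intro tendsto_real_sqrt summable_LIMSEQ_zero square_summable_trajectory u)
  then have "c \<longlonglongrightarrow> \<kappa> * 0"
    unfolding c_def by (intro tendsto_mult_left) simp
  then have c_lim: "c \<longlonglongrightarrow> 0" by simp
  have "(\<lambda>M. (\<Sum>t<M. form (p t))
      + S_bound * (c M * ((\<Sum>t<M. (norm (p t))\<^sup>2) + 2) + 2 * (c M)\<^sup>2))
    \<longlonglongrightarrow> (\<Sum>t. form (p t)) + S_bound * (0 * ((\<Sum>t. (norm (p t))\<^sup>2) + 2) + 2 * 0\<^sup>2)"
    by (intro tendsto_intros c_lim summable_LIMSEQ summ_p)
      (auto simp: p_def y_def intro: summable_form u)
  moreover have "(\<lambda>M. \<delta> * (\<Sum>t<M. (norm (u t))\<^sup>2)) \<longlonglongrightarrow> \<delta> * (\<Sum>t. (norm (u t))\<^sup>2)"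
    by (intro tendsto_intros summable_LIMSEQ u)
  moreover have "\<forall>\<^sub>F M in sequentially. \<delta> * (\<Sum>t<M. (norm (u t))\<^sup>2) \<le> (\<Sum>t<M. form (p t))
      + S_bound * (c M * ((\<Sum>t<M. (norm (p t))\<^sup>2) + 2) + 2 * (c M)\<^sup>2)"
    using eventually_gt_at_top[of 0] by eventually_elim (rule main)
  ultimately have "\<delta> * (\<Sum>t. (norm (u t))\<^sup>2)
      \<le> (\<Sum>t. form (p t)) + S_bound * (0 * ((\<Sum>t. (norm (p t))\<^sup>2) + 2) + 2 * 0\<^sup>2)"
    by (rule tendsto_le[OF trivial_limit_sequentially])
  then show ?thesis
    by (simp add: quadratic_cost_def p_def y_def)
qed

section \<open>Existence and uniqueness conditions for minimizers\<close>

text \<open>Both \<open>u + w\<close> and \<open>u - w\<close> compete with \<open>u\<close>, and by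
  the parallelogram identity their costs exceed twice the minimum by exactly twice the cost of
  \<open>w\<close> started at 0.\<close>

lemma minimizer_cost_nonneg:
  assumes u: "summable (\<lambda>t. (norm (u t))\<^sup>2)"
    and min: "\<And>v. summable (\<lambda>t. (norm (v t))\<^sup>2) \<Longrightarrow> quadratic_cost x u \<le> quadratic_cost x v"
    and w: "summable (\<lambda>t. (norm (w t))\<^sup>2)"
  shows "0 \<le> quadratic_cost 0 w"
  using quadratic_cost_parallelogram[OF u w, of x] min[OF square_summable_add[OF u w]]
    min[OF square_summable_add[OF u, of "\<lambda>t. - w t"]] w
  by simp

lemma minimizer_unique:
  assumes "\<delta> > 0"
    and coercive: "\<And>\<theta> g h v w. harmonic \<theta> g h v w \<Longrightarrow>
      \<delta> * ((norm v)\<^sup>2 + (norm w)\<^sup>2) \<le> form (g, v) + form (h, w)"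
    and u: "summable (\<lambda>t. (norm (u t))\<^sup>2)" and v: "summable (\<lambda>t. (norm (v t))\<^sup>2)"
    and min_u: "\<And>w. summable (\<lambda>t. (norm (w t))\<^sup>2) \<Longrightarrow> quadratic_cost x u \<le> quadratic_cost x w"
    and min_v: "\<And>w. summable (\<lambda>t. (norm (w t))\<^sup>2) \<Longrightarrow> quadratic_cost x v \<le> quadratic_cost x w"
  shows "u t = v t"
proof -
  \<comment> \<open>Midpoint and half difference: \<open>w + d\<close> and \<open>w - d\<close> are
    the two minimizers. Since \<open>w\<close> costs at least the minimum, the parallelogram
    identity leaves a nonpositive cost for \<open>d\<close>.\<close>
  define w d where "w t = (1 / 2) *\<^sub>R (u t + v t)" and "d t = (1 / 2) *\<^sub>R (u t - v t)" for t
  have w: "summable (\<lambda>t. (norm (w t))\<^sup>2)" and d: "summable (\<lambda>t. (norm (d t))\<^sup>2)"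
    using square_summable_add[OF u v] square_summable_add[OF u, of "\<lambda>t. - v t"] v
    by (auto simp: w_def d_def power_divide)
  have wd: "w t + d t = u t" "w t - d t = v t" for t
    unfolding w_def d_def scaleR_add_right[symmetric] scaleR_diff_right[symmetric]
    by (simp_all flip: scaleR_2)
  have "\<delta> * (\<Sum>t. (norm (d t))\<^sup>2) \<le> quadratic_cost 0 d"
    by (rule coercive_cost[OF coercive d])
  also have "\<dots> \<le> 0"
    using quadratic_cost_parallelogram[OF w d, of x] min_u[OF w] min_v[OF w] by (simp add: wd)
  finally have "(\<Sum>t. (norm (d t))\<^sup>2) \<le> 0"
    using \<open>\<delta> > 0\<close> by (simp add: mult_le_0_iff)
  then have "(\<Sum>t. (norm (d t))\<^sup>2) = 0"
    using suminf_nonneg[OF d] by simp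
  then have "d t = 0"
    using suminf_eq_zero_iff[OF d] by simp
  then show ?thesis by (simp add: d_def)
qed

end

section \<open>Matrices and the frequency form\<close>

lemma inner_transpose:
  fixes K :: "real ^ 'n ^ 'm"
  shows "x \<bullet> (transpose K *v y) = (K *v x) \<bullet> y"
  unfolding transpose_matrix_vector by (metis dot_lmul_matrix inner_commute)

lemma inner_transpose_left:
  fixes K :: "real ^ 'n ^ 'm"
  shows "(transpose K *v y) \<bullet> x = (K *v x) \<bullet> y"
  by (metis inner_transpose inner_commute)

definition re_vec :: "complex ^ 'n \<Rightarrow> real ^ 'n" where
  "re_vec x = (\<chi> i. Re (x $ i))"

definition im_vec :: "complex ^ 'n \<Rightarrow> real ^ 'n" where
  "im_vec x = (\<chi> i. Im (x $ i))"

lemma re_vec_nth [simp]: "re_vec x $ i = Re (x $ i)"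
  and im_vec_nth [simp]: "im_vec x $ i = Im (x $ i)"
  by (simp_all add: re_vec_def im_vec_def)

lemma complex_vec_eq_iff: "x = y \<longleftrightarrow> re_vec x = re_vec y \<and> im_vec x = im_vec y"
  by (auto simp: vec_eq_iff complex_eq_iff)

lemma re_vec_cmat: "re_vec (cmat K *v x) = K *v re_vec x"
  and im_vec_cmat: "im_vec (cmat K *v x) = K *v im_vec x"
  by (simp_all add: vec_eq_iff matrix_vector_mult_def Re_sum Im_sum)

lemma re_vec_add: "re_vec (x + y) = re_vec x + re_vec y"
  and im_vec_add: "im_vec (x + y) = im_vec x + im_vec y"
  and re_vec_scale: "re_vec (z *s x) = Re z *\<^sub>R re_vec x - Im z *\<^sub>R im_vec x"
  and im_vec_scale: "im_vec (z *s x) = Im z *\<^sub>R re_vec x + Re z *\<^sub>R im_vec x"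
  by (simp_all add: vec_eq_iff)

lemma cdot_eq:
  "cdot x y = Complex (re_vec x \<bullet> re_vec y + im_vec x \<bullet> im_vec y)
    (re_vec x \<bullet> im_vec y - im_vec x \<bullet> re_vec y)"
  by (simp add: complex_eq_iff cdot_def inner_vec_def Re_sum Im_sum sum.distrib sum_subtractf)

lemma norm_complex_vec: "(norm x)\<^sup>2 = (norm (re_vec x))\<^sup>2 + (norm (im_vec x))\<^sup>2"
  for x :: "complex ^ 'n"
  unfolding power2_norm_eq_inner
  by (simp add: inner_vec_def inner_complex_def power2_eq_square sum.distrib)

lemma cdot_cmat_symmetric:
  assumes "transpose K = K"
  shows "cdot x (cmat K *v x)
    = complex_of_real (re_vec x \<bullet> (K *v re_vec x) + im_vec x \<bullet> (K *v im_vec x))"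
proof -
  have "re_vec x \<bullet> (K *v im_vec x) = im_vec x \<bullet> (K *v re_vec x)"
    using inner_transpose[of "re_vec x" K "im_vec x"] by (simp add: assms inner_commute)
  then show ?thesis
    by (simp add: cdot_eq re_vec_cmat im_vec_cmat complex_eq_iff)
qed

text \<open>Symmetric real matrices do not couple real and imaginary parts, so the complex
  inequality becomes one about the sum of two values of a real form, as in
  \<open>frequency_nonneg\<close> and \<open>coercive_cost\<close>.\<close>

lemma frequency_form_eq:
  fixes \<gamma> :: "real ^ 'm ^ 'n"
  assumes "transpose \<Theta> = \<Theta>" "transpose \<Gamma> = \<Gamma>"
  shows "frequency_form (cmat \<Theta>) \<gamma> \<Gamma> x u = complex_of_real
     ((re_vec x \<bullet> (\<Theta> *v re_vec x) + 2 * (re_vec x \<bullet> (\<gamma> *v re_vec u)) + re_vec u \<bullet> (\<Gamma> *v re_vec u))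
    + (im_vec x \<bullet> (\<Theta> *v im_vec x) + 2 * (im_vec x \<bullet> (\<gamma> *v im_vec u)) + im_vec u \<bullet> (\<Gamma> *v im_vec u)))"
  by (simp add: frequency_form_def cdot_cmat_symmetric assms cdot_eq[of x "cmat \<gamma> *v u"]
      re_vec_cmat im_vec_cmat)

lemma mat_mult_vec: "mat z *v x = z *s x" for x :: "'a::comm_semiring_1 ^ 'n"
  by (simp add: vec_eq_iff matrix_vector_mult_def mat_def if_distrib[of "\<lambda>y. y * _"] cong: if_cong)

lemma resolvent_equation:
  fixes A :: "real ^ 'n ^ 'n"
  assumes ker: "\<And>x. z *s x = cmat A *v x \<Longrightarrow> x = 0"
  shows "z *s x = cmat A *v x + y \<longleftrightarrow> x = resolvent A z *v y"
proof -
  let ?R = "mat z - cmat A"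
  have R: "?R *v x = z *s x - cmat A *v x" for x
    by (simp add: matrix_vector_mult_diff_rdistrib mat_mult_vec)
  \<comment> \<open>A trivial kernel makes the square matrix invertible, so the choice inside
    \<open>matrix_inv\<close> picks a true two-sided inverse.\<close>
  have "invertible ?R"
    unfolding invertible_left_inverse matrix_left_invertible_ker
    using ker by (simp add: R)
  then have "?R ** resolvent A z = mat 1" "resolvent A z ** ?R = mat 1"
    unfolding resolvent_def invertible_def matrix_inv_def by (metis (mono_tags, lifting) someI_ex)+
  then have "?R *v (resolvent A z *v y) = y" "resolvent A z *v (?R *v x) = x"
    by (simp_all add: matrix_vector_mul_assoc)
  moreover have "z *s x = cmat A *v x + y \<longleftrightarrow> ?R *v x = y"
    unfolding R by (metis add_diff_cancel_left' diff_add_cancel add.commute)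
  ultimately show ?thesis by metis
qed

section \<open>The Lyapunov operator and real quadratic forms\<close>

text \<open>The adjoint of the map that propagates second moments in the uncontrolled system: it
  carries the weight \<open>K\<close> of a quadratic form one time step back.\<close>

definition lyapunov_op :: "real ^ 'n ^ 'n \<Rightarrow> real ^ 'n ^ 'n \<Rightarrow> real ^ 'n ^ 'n \<Rightarrow> real ^ 'n ^ 'n" where
  "lyapunov_op A C K = transpose A ** K ** A + transpose C ** K ** C"

lemma quadratic_form_congruence:
  fixes K :: "real ^ 'n ^ 'n"
  shows "x \<bullet> ((transpose P ** K ** Q) *v y) = (P *v x) \<bullet> (K *v (Q *v y))"
  by (simp add: matrix_vector_mul_assoc[symmetric] inner_transpose del: transpose_matrix_vector)

lemma lyapunov_op_form:
  "x \<bullet> (lyapunov_op A C K *v x) = (A *v x) \<bullet> (K *v (A *v x)) + (C *v x) \<bullet> (K *v (C *v x))"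
  by (simp add: lyapunov_op_def matrix_vector_mult_add_rdistrib inner_add_right quadratic_form_congruence)

lemma transpose_add: "transpose (P + Q) = transpose P + transpose Q"
  by (simp add: transpose_def vec_eq_iff)

lemma transpose_lyapunov_op:
  "transpose K = K \<Longrightarrow> transpose (lyapunov_op A C K) = lyapunov_op A C K"
  by (simp add: lyapunov_op_def transpose_add matrix_transpose_mul matrix_mul_assoc)

lemma transpose_lyapunov_op_funpow:
  "transpose K = K \<Longrightarrow> transpose ((lyapunov_op A C ^^ t) K) = (lyapunov_op A C ^^ t) K"
  by (induction t) (simp_all add: transpose_lyapunov_op)

lemma symmetric_polarization:
  fixes K :: "real ^ 'n ^ 'n"
  assumes "transpose K = K"
  shows "K $ i $ j = ((axis i 1 + axis j 1) \<bullet> (K *v (axis i 1 + axis j 1))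
    - axis i 1 \<bullet> (K *v axis i 1) - axis j 1 \<bullet> (K *v axis j 1)) / 2"
proof -
  have entry: "axis i 1 \<bullet> (K *v axis j 1) = K $ i $ j" for i j
    by (simp add: inner_axis' matrix_vector_mul_component inner_axis)
  have "K $ j $ i = K $ i $ j"
    using assms by (metis transpose_def vec_lambda_beta)
  then show ?thesis
    by (simp add: matrix_vector_right_distrib inner_add entry)
qed

text \<open>By polarization the entries of a symmetric matrix are combinations of values of its
  quadratic form.\<close>

lemma tendsto_symmetric_zero:
  fixes K :: "'b \<Rightarrow> real ^ 'n ^ 'n"
  assumes "\<And>t. transpose (K t) = K t" and "\<And>x. ((\<lambda>t. x \<bullet> (K t *v x)) \<longlongrightarrow> 0) G"
  shows "(K \<longlongrightarrow> 0) G"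
proof (intro vec_tendstoI)
  fix i j
  have "((\<lambda>t. ((axis i 1 + axis j 1) \<bullet> (K t *v (axis i 1 + axis j 1))
    - axis i 1 \<bullet> (K t *v axis i 1) - axis j 1 \<bullet> (K t *v axis j 1)) / 2) \<longlongrightarrow> (0 - 0 - 0) / 2) G"
    by (intro tendsto_intros assms) simp
  then show "((\<lambda>t. K t $ i $ j) \<longlongrightarrow> 0 $ i $ j) G"
    by (simp add: symmetric_polarization[OF assms(1)])
qed

lemma matrix_add_rdistrib: "(P + Q) ** K = P ** K + Q ** K"
  by (simp add: vec_eq_iff matrix_matrix_mult_def sum.distrib distrib_right)

lemma linear_lyapunov_op: "linear (lyapunov_op A C)"
  unfolding lyapunov_op_def
  by (rule linearI)
    (simp_all add: matrix_add_ldistrib matrix_add_rdistrib matrix_scalar_ac scaleR_add_right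
      flip: scalar_matrix_assoc)

text \<open>Decay is only known on symmetric matrices; composing with the symmetrization gives an operator
  all of whose orbits vanish, to which the general summability bound applies.\<close>

lemma summable_lyapunov_orbit:
  fixes K :: "real ^ 'n ^ 'n"
  assumes lim: "\<And>K. transpose K = K \<Longrightarrow> (\<lambda>t. (lyapunov_op A C ^^ t) K) \<longlonglongrightarrow> 0"
    and K: "transpose K = K"
  shows "summable (\<lambda>t. norm ((lyapunov_op A C ^^ t) K))"
proof -
  define s :: "real ^ 'n ^ 'n \<Rightarrow> real ^ 'n ^ 'n" where "s K = (1 / 2) *\<^sub>R (K + transpose K)" for K
  define T where "T = lyapunov_op A C \<circ> s"
  have s_sym: "transpose (s K) = s K" for K
    by (simp add: s_def vec_eq_iff transpose_def)
  have s_id: "s K = K" if "transpose K = K" for K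
    using that by (simp add: s_def flip: scaleR_2)
  have T_sym: "(T ^^ t) K = (lyapunov_op A C ^^ t) K" if "transpose K = K" for t K
    by (induction t) (simp_all add: T_def s_id transpose_lyapunov_op_funpow that)
  have "linear s"
    by (rule linearI) (simp_all add: s_def vec_eq_iff transpose_def algebra_simps)
  then have "linear T"
    unfolding T_def by (rule linear_compose[OF _ linear_lyapunov_op])
  have "(\<lambda>t. (T ^^ Suc t) K) \<longlonglongrightarrow> 0" for K
    using lim[OF transpose_lyapunov_op[OF s_sym, of A C K]]
      T_sym[OF transpose_lyapunov_op[OF s_sym, of A C K]]
    unfolding funpow_Suc_right by (simp add: T_def)
  then have "(\<lambda>t. (T ^^ t) K) \<longlonglongrightarrow> 0" for K
    by (rule LIMSEQ_imp_Suc)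
  then obtain \<kappa> where \<kappa>: "\<And>K n. (\<Sum>k<n. norm ((T ^^ k) K)) \<le> \<kappa> * norm K"
    using orbit_sum_bound[OF \<open>linear T\<close>] by metis
  have "summable (\<lambda>t. norm ((T ^^ t) K))"
    by (rule summableI_nonneg_bounded[OF _ \<kappa>]) auto
  then show ?thesis
    by (simp add: T_sym[OF K])
qed

text \<open>The norm of \<open>K\<close> is the Frobenius norm; Cauchy-Schwarz in each row shows
  that it dominates the operator norm.\<close>

lemma quadratic_form_bound:
  fixes K :: "real ^ 'n ^ 'n"
  shows "\<bar>x \<bullet> (K *v x)\<bar> \<le> norm K * (norm x)\<^sup>2"
proof -
  have "norm (K *v x) \<le> norm K * norm x"
  proof -
    have "(norm (K *v x))\<^sup>2 = (\<Sum>i\<in>UNIV. (K $ i \<bullet> x)\<^sup>2)"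
      by (simp add: norm_vec_def L2_set_def sum_nonneg matrix_vector_mul_component)
    also have "\<dots> \<le> (\<Sum>i\<in>UNIV. (norm (K $ i))\<^sup>2 * (norm x)\<^sup>2)"
      by (intro sum_mono) (metis Cauchy_Schwarz_ineq power2_norm_eq_inner)
    also have "\<dots> = (norm K * norm x)\<^sup>2"
      by (simp add: power_mult_distrib sum_distrib_right[symmetric] norm_vec_def[of K] L2_set_def sum_nonneg)
    finally show ?thesis
      by (rule power2_le_imp_le) simp
  qed
  then have "\<bar>x \<bullet> (K *v x)\<bar> \<le> norm x * (norm K * norm x)"
    by (meson Cauchy_Schwarz_ineq2 mult_left_mono norm_ge_zero order_trans)
  then show ?thesis by (simp add: power2_eq_square mult_ac)
qed

lemma map_matrix_Re_Im:
  fixes X :: "complex ^ 'k ^ 'n" and Y :: "complex ^ 'n ^ 'k"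
  shows "map_matrix Re (cmat P ** X) = P ** map_matrix Re X"
    and "map_matrix Im (cmat P ** X) = P ** map_matrix Im X"
    and "map_matrix Re (Y ** cmat P) = map_matrix Re Y ** P"
    and "map_matrix Im (Y ** cmat P) = map_matrix Im Y ** P"
  by (simp_all add: vec_eq_iff matrix_matrix_mult_def Re_sum Im_sum)

lemma complex_mat_eq_iff:
  "X = Y \<longleftrightarrow> map_matrix Re X = map_matrix Re Y \<and> map_matrix Im X = map_matrix Im Y"
  by (auto simp: vec_eq_iff complex_eq_iff)

lemma transpose_cmat: "transpose (cmat P) = cmat (transpose P)"
  by (simp add: vec_eq_iff transpose_def)

text \<open>The whole cross term sits in one off-diagonal block, hence the factor 2. Only the
  quadratic form of this operator matters, so it is not symmetrized.\<close>

definition form_op :: "real ^ 'n ^ 'n \<Rightarrow> real ^ 'm ^ 'n \<Rightarrow> real ^ 'm ^ 'm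
    \<Rightarrow> (real ^ 'n) \<times> (real ^ 'm) \<Rightarrow> (real ^ 'n) \<times> (real ^ 'm)" where
  "form_op \<Theta> \<gamma> \<Gamma> p = (\<Theta> *v fst p + 2 *\<^sub>R (\<gamma> *v snd p), \<Gamma> *v snd p)"

lemma linear_form_op: "linear (form_op \<Theta> \<gamma> \<Gamma>)"
  by (rule linearI)
    (simp_all add: form_op_def matrix_vector_right_distrib matrix_vector_mult_scaleR scaleR_add_right)

lemma inner_form_op:
  "(x, v) \<bullet> form_op \<Theta> \<gamma> \<Gamma> (x, v) = x \<bullet> (\<Theta> *v x) + 2 * (x \<bullet> (\<gamma> *v v)) + v \<bullet> (\<Gamma> *v v)"
  by (simp add: form_op_def inner_add_right)

section \<open>Moments of the stochastic system\<close>

context white_noise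
begin

lemma measurable_from_F: "f \<in> measurable (F t) N \<Longrightarrow> f \<in> measurable M N"
  by (rule measurable_from_subalg[OF subalgebra_F])

lemma measurable_F_Suc: "f \<in> measurable (F t) N \<Longrightarrow> f \<in> measurable (F (Suc t)) N"
  by (rule measurable_from_subalg[rotated]) (auto simp: subalgebra_def space_F intro: sets_F_mono[THEN subsetD, of t "Suc t"])

text \<open>The sets generated by \<open>f\<close> lie in \<open>F t\<close>, so the independence of
  \<open>F t\<close> from the next noise value restricts to them.\<close>

lemma indep_var_noise:
  assumes f: "f \<in> borel_measurable (F t)"
  shows "indep_var borel f borel (\<xi> (Suc t))"
  unfolding indep_var_eq
proof (intro conjI)
  show "f \<in> borel_measurable M"
    by (rule measurable_from_F[OF f])
  show "\<xi> (Suc t) \<in> borel_measurable M"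
    by (rule measurable_from_F[OF adapted])
  have "sigma_sets (space M) {f -` A \<inter> space M |A. A \<in> sets borel} \<subseteq> sets (F t)"
    using sets.sigma_sets_subset[of "{f -` A \<inter> space M |A. A \<in> sets borel}" "F t"] f
    by (auto simp: space_F measurable_sets intro!: measurable_sets[OF f, unfolded space_F])
  moreover have "sets (vimage_algebra (space M) (\<xi> (Suc t)) borel)
      = sigma_sets (space M) {\<xi> (Suc t) -` A \<inter> space M |A. A \<in> sets borel}"
    by (rule sets_vimage_algebra)
  ultimately show "indep_set (sigma_sets (space M) {f -` A \<inter> space M |A. A \<in> sets borel})
      (sigma_sets (space M) {\<xi> (Suc t) -` A \<inter> space M |A. A \<in> sets borel})"
    using indep_noise[of t] unfolding indep_set_def
    by (elim indep_sets_mono_sets) (auto split: bool.split)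
qed

lemma
  assumes f: "f \<in> borel_measurable (F t)" "integrable M f"
  shows integrable_mult_noise: "integrable M (\<lambda>\<omega>. \<xi> (Suc t) \<omega> * f \<omega>)"
    and expectation_mult_noise: "expectation (\<lambda>\<omega>. \<xi> (Suc t) \<omega> * f \<omega>) = 0"
    and integrable_mult_noise_square: "integrable M (\<lambda>\<omega>. (\<xi> (Suc t) \<omega>)\<^sup>2 * f \<omega>)"
    and expectation_mult_noise_square: "expectation (\<lambda>\<omega>. (\<xi> (Suc t) \<omega>)\<^sup>2 * f \<omega>) = expectation f"
proof -
  note iv = indep_var_noise[OF f(1)]
  have iv2: "indep_var borel f borel (\<lambda>\<omega>. (\<xi> (Suc t) \<omega>)\<^sup>2)"
    using indep_var_compose[OF iv, of "\<lambda>x. x" borel "\<lambda>x. x\<^sup>2" borel] by (simp add: o_def)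
  have one: "expectation (\<lambda>\<omega>. (\<xi> (Suc t) \<omega>)\<^sup>2) = 1"
    using variance_noise[of "Suc t"] by (simp add: mean_noise)
  show "integrable M (\<lambda>\<omega>. \<xi> (Suc t) \<omega> * f \<omega>)"
    using indep_var_integrable[OF iv f(2) integrable_noise] by (simp add: mult.commute)
  show "expectation (\<lambda>\<omega>. \<xi> (Suc t) \<omega> * f \<omega>) = 0"
    using indep_var_lebesgue_integral[OF iv f(2) integrable_noise] by (simp add: mult.commute mean_noise)
  show "integrable M (\<lambda>\<omega>. (\<xi> (Suc t) \<omega>)\<^sup>2 * f \<omega>)"
    using indep_var_integrable[OF iv2 f(2) integrable_noise_square] by (simp add: mult.commute)
  show "expectation (\<lambda>\<omega>. (\<xi> (Suc t) \<omega>)\<^sup>2 * f \<omega>) = expectation f"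
    using indep_var_lebesgue_integral[OF iv2 f(2) integrable_noise_square] by (simp add: mult.commute one)
qed

text \<open>Shaped to fit \<open>quadratic_step\<close>: the part linear in the noise averages out,
  and the coefficient of its square survives with weight 1.\<close>

lemma expectation_noise_polynomial:
  assumes f: "integrable M f" and g: "integrable M g"
    and h: "h \<in> borel_measurable (F t)" "integrable M h"
    and k: "k \<in> borel_measurable (F t)" "integrable M k"
  shows "expectation (\<lambda>\<omega>. f \<omega> + g \<omega> + c + \<xi> (Suc t) \<omega> * h \<omega> + (\<xi> (Suc t) \<omega>)\<^sup>2 * k \<omega>)
    = expectation f + expectation g + c + expectation k"
  by (simp add: f g integrable_mult_noise[OF h] expectation_mult_noise[OF h]
      integrable_mult_noise_square[OF k] expectation_mult_noise_square[OF k] prob_space)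

text \<open>A constant generates the trivial sigma-algebra, which is independent of everything.
  Mean-square stability can therefore be tested on deterministic initial states.\<close>

lemma initial_vector_const: "initial_vector (\<lambda>_. c)"
  unfolding initial_vector_def
proof (intro conjI)
  let ?V = "vimage_algebra (space M) (\<lambda>\<omega> t. \<xi> t \<omega>) (\<Pi>\<^sub>M t\<in>UNIV. borel)"
  show "indep_set (sets (vimage_algebra (space M) (\<lambda>_. c) borel)) (sets ?V)"
  proof (rule indep_setI)
    have triv: "sets (vimage_algebra (space M) (\<lambda>_. c) borel) \<subseteq> {{}, space M}"
    proof -
      have "sigma_sets (space M) {(\<lambda>_. c) -` A \<inter> space M |A. A \<in> sets borel} \<subseteq> {{}, space M}"
        by (rule sigma_algebra.sigma_sets_subset[OF sigma_algebra_trivial]) auto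
      then show ?thesis
        by (simp add: sets_vimage_algebra)
    qed
    then show "sets (vimage_algebra (space M) (\<lambda>_. c) borel) \<subseteq> events"
      by (rule subset_trans) auto
    have "(\<lambda>\<omega> t. \<xi> t \<omega>) \<in> measurable M (\<Pi>\<^sub>M t\<in>UNIV. borel)"
      by (intro measurable_PiM_single') (auto intro: measurable_from_F[OF adapted])
    then show V: "sets ?V \<subseteq> events"
      unfolding sets_vimage_algebra
      by (intro sets.sigma_sets_subset) (auto intro: measurable_sets)
    fix a b assume a: "a \<in> sets (vimage_algebra (space M) (\<lambda>_. c) borel)" and b: "b \<in> sets ?V"
    then have "b \<in> events" using V by blast
    from a triv consider "a = {}" | "a = space M" by blast
    then show "prob (a \<inter> b) = prob a * prob b"
    proof cases
      case 2
      then show ?thesis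
        using sets.Int_space_eq1[OF \<open>b \<in> events\<close>] by (simp add: prob_space)
    qed simp
  qed
qed auto

end

section \<open>First and second moments along a controlled trajectory\<close>

locale controlled_system = white_noise M F \<xi>
  for M :: "'w measure" and F :: "nat \<Rightarrow> 'w measure" and \<xi> :: "nat \<Rightarrow> 'w \<Rightarrow> real" +
  fixes A C :: "real ^ 'n ^ 'n" and b :: "real ^ 'm ^ 'n" and a :: "'w \<Rightarrow> real ^ 'n"
    and u :: "nat \<Rightarrow> real ^ 'm"
  assumes measurable_a: "a \<in> borel_measurable (F 0)"
    and integrable_a: "integrable M (\<lambda>\<omega>. (norm (a \<omega>))\<^sup>2)"
begin

sublocale mean: linear_system "(*v) A" "(*v) b"
  by (rule linear_system.intro) (rule matrix_vector_mul_linear)+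

abbreviation x :: "nat \<Rightarrow> 'w \<Rightarrow> real ^ 'n" where
  "x \<equiv> state A b C a u"

definition m :: "nat \<Rightarrow> real ^ 'n" where
  "m = mean.trajectory (expectation a) u"

lemma m_Suc: "m (Suc t) = A *v m t + b *v u t"
  by (simp add: m_def)

lemma measurable_x: "x t \<in> borel_measurable (F t)"
proof (induction t)
  case 0
  then show ?case by (simp add: measurable_a)
next
  case (Suc t)
  have x: "x t \<in> borel_measurable (F (Suc t))"
    by (rule measurable_F_Suc[OF Suc])
  have mult: "(\<lambda>\<omega>. K *v x t \<omega>) \<in> borel_measurable (F (Suc t))" for K :: "real ^ 'n ^ 'n"
    by (rule measurable_compose[OF x borel_measurable_continuous_onI])
      (intro linear_continuous_on matrix_vector_mul_bounded_linear)
  show ?case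
    using mult adapted[of "Suc t"] by simp
qed

lemma measurable_linear: "(\<lambda>\<omega>. c \<bullet> x t \<omega>) \<in> borel_measurable (F t)"
  using measurable_x[of t] by simp

lemma measurable_quadratic: "(\<lambda>\<omega>. x t \<omega> \<bullet> (K *v x t \<omega>)) \<in> borel_measurable (F t)"
proof -
  have "(\<lambda>\<omega>. K *v x t \<omega>) \<in> borel_measurable (F t)"
    by (rule measurable_compose[OF measurable_x borel_measurable_continuous_onI])
      (intro linear_continuous_on matrix_vector_mul_bounded_linear)
  then show ?thesis
    using measurable_x[of t] by simp
qed

text \<open>Expansion in powers of the next noise value. All coefficients are determined at time
  \<open>t\<close>, so expectations can be taken term by term; both \<open>K\<close> and its
  transpose occur because \<open>K\<close> is arbitrary here.\<close>

lemma quadratic_step: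
  "x (Suc t) \<omega> \<bullet> (K *v x (Suc t) \<omega>)
    = x t \<omega> \<bullet> ((transpose A ** K ** A) *v x t \<omega>)
    + (transpose A *v (K *v (b *v u t)) + transpose A *v (transpose K *v (b *v u t))) \<bullet> x t \<omega>
    + (b *v u t) \<bullet> (K *v (b *v u t))
    + \<xi> (Suc t) \<omega> * (x t \<omega> \<bullet> ((transpose A ** K ** C + transpose C ** K ** A) *v x t \<omega>)
      + (transpose C *v (K *v (b *v u t)) + transpose C *v (transpose K *v (b *v u t))) \<bullet> x t \<omega>)
    + (\<xi> (Suc t) \<omega>)\<^sup>2 * (x t \<omega> \<bullet> ((transpose C ** K ** C) *v x t \<omega>))"
  by (simp add: quadratic_form_congruence inner_transpose_left inner_transpose
      matrix_vector_mult_add_rdistrib matrix_vector_right_distrib matrix_vector_mult_scaleR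
      inner_add_left inner_add_right power2_eq_square distrib_left inner_commute[of "b *v u t"]
      del: transpose_matrix_vector)

lemma linear_step:
  "c \<bullet> x (Suc t) \<omega> = (transpose A *v c) \<bullet> x t \<omega> + c \<bullet> (b *v u t)
    + \<xi> (Suc t) \<omega> * ((transpose C *v c) \<bullet> x t \<omega>)"
  by (simp add: inner_transpose_left inner_commute[of c] inner_add_left del: transpose_matrix_vector)

lemma integrable_from_square:
  assumes "integrable M (\<lambda>\<omega>. (norm (x t \<omega>))\<^sup>2)"
  shows "integrable M (\<lambda>\<omega>. c \<bullet> x t \<omega>)" "integrable M (\<lambda>\<omega>. x t \<omega> \<bullet> (K *v x t \<omega>))"
proof -
  show "integrable M (\<lambda>\<omega>. c \<bullet> x t \<omega>)"
  proof (rule Bochner_Integration.integrable_bound)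
    show "integrable M (\<lambda>\<omega>. norm c * (1 + (norm (x t \<omega>))\<^sup>2))"
      using assms by simp
    have "\<bar>c \<bullet> y\<bar> \<le> norm c * (1 + (norm y)\<^sup>2)" for y
    proof -
      have "norm y \<le> 1 + (norm y)\<^sup>2"
        using sum_squares_bound[of "norm y" 1] by simp (smt (verit) norm_ge_zero)
      then show ?thesis
        by (meson Cauchy_Schwarz_ineq2 mult_left_mono norm_ge_zero order_trans)
    qed
    then show "AE \<omega> in M. norm (c \<bullet> x t \<omega>) \<le> norm (norm c * (1 + (norm (x t \<omega>))\<^sup>2))"
      by (simp add: abs_mult)
  qed (rule measurable_from_F[OF measurable_linear])
  show "integrable M (\<lambda>\<omega>. x t \<omega> \<bullet> (K *v x t \<omega>))"
  proof (rule Bochner_Integration.integrable_bound)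
    show "integrable M (\<lambda>\<omega>. norm K * (norm (x t \<omega>))\<^sup>2)"
      using assms by simp
    show "AE \<omega> in M. norm (x t \<omega> \<bullet> (K *v x t \<omega>)) \<le> norm (norm K * (norm (x t \<omega>))\<^sup>2)"
      by (simp add: quadratic_form_bound)
  qed (rule measurable_from_F[OF measurable_quadratic])
qed

lemma integrable_norm_square: "integrable M (\<lambda>\<omega>. (norm (x t \<omega>))\<^sup>2)"
proof (induction t)
  case 0
  then show ?case by (simp add: integrable_a)
next
  case (Suc t)
  \<comment> \<open>The identity matrix turns the quadratic expansion into one of the squared
    norm.\<close>
  have "integrable M (\<lambda>\<omega>. x (Suc t) \<omega> \<bullet> (mat 1 *v x (Suc t) \<omega>))"
    unfolding quadratic_step
    by (intro Bochner_Integration.integrable_add integrable_mult_noise integrable_mult_noise_square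
        borel_measurable_add measurable_linear measurable_quadratic integrable_from_square[OF Suc]
        integrable_const)
  then show ?case
    by (simp only: matrix_vector_mul_lid power2_norm_eq_inner)
qed

lemmas integrable_linear = integrable_from_square(1)[OF integrable_norm_square]
lemmas integrable_quadratic = integrable_from_square(2)[OF integrable_norm_square]

lemma expectation_linear: "expectation (\<lambda>\<omega>. c \<bullet> x t \<omega>) = c \<bullet> m t"
proof (induction t arbitrary: c)
  case 0
  have "integrable M a"
  proof (rule Bochner_Integration.integrable_bound)
    show "integrable M (\<lambda>\<omega>. 1 + (norm (a \<omega>))\<^sup>2)"
      using integrable_a by simp
    have "norm y \<le> 1 + (norm y)\<^sup>2" for y :: "real ^ 'n"
      using sum_squares_bound[of "norm y" 1] by simp (smt (verit) norm_ge_zero)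
    then show "AE \<omega> in M. norm (a \<omega>) \<le> norm (1 + (norm (a \<omega>))\<^sup>2)"
      by simp
  qed (rule measurable_from_F[OF measurable_a])
  then show ?case
    by (simp add: m_def)
next
  case (Suc t)
  have "expectation (\<lambda>\<omega>. c \<bullet> x (Suc t) \<omega>)
    = expectation (\<lambda>\<omega>. (transpose A *v c) \<bullet> x t \<omega>) + c \<bullet> (b *v u t)"
    unfolding linear_step
    by (simp add: integrable_linear integrable_mult_noise expectation_mult_noise measurable_linear
        prob_space del: transpose_matrix_vector)
  also have "\<dots> = c \<bullet> (A *v m t) + c \<bullet> (b *v u t)"
    unfolding Suc by (metis inner_transpose inner_commute)
  finally show ?case
    by (simp add: m_Suc inner_add_right)
qed

text \<open>The trace of \<open>K\<close> times the covariance matrix of the state, written without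
  that matrix.\<close>

definition covariance_form :: "real ^ 'n ^ 'n \<Rightarrow> nat \<Rightarrow> real" where
  "covariance_form K t = expectation (\<lambda>\<omega>. x t \<omega> \<bullet> (K *v x t \<omega>)) - m t \<bullet> (K *v m t)"

lemma expectation_quadratic_Suc:
  "expectation (\<lambda>\<omega>. x (Suc t) \<omega> \<bullet> (K *v x (Suc t) \<omega>))
    = expectation (\<lambda>\<omega>. x t \<omega> \<bullet> (lyapunov_op A C K *v x t \<omega>))
    + (A *v m t) \<bullet> (K *v (b *v u t)) + (b *v u t) \<bullet> (K *v (A *v m t))
    + (b *v u t) \<bullet> (K *v (b *v u t))"
proof -
  let ?c = "transpose A *v (K *v (b *v u t)) + transpose A *v (transpose K *v (b *v u t))"
  have "expectation (\<lambda>\<omega>. x (Suc t) \<omega> \<bullet> (K *v x (Suc t) \<omega>))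
    = expectation (\<lambda>\<omega>. x t \<omega> \<bullet> ((transpose A ** K ** A) *v x t \<omega>))
      + ?c \<bullet> m t + (b *v u t) \<bullet> (K *v (b *v u t))
      + expectation (\<lambda>\<omega>. x t \<omega> \<bullet> ((transpose C ** K ** C) *v x t \<omega>))"
    unfolding quadratic_step expectation_linear[symmetric]
    by (intro expectation_noise_polynomial borel_measurable_add measurable_linear measurable_quadratic
        Bochner_Integration.integrable_add integrable_linear integrable_quadratic)
  moreover have "?c \<bullet> m t = (A *v m t) \<bullet> (K *v (b *v u t)) + (b *v u t) \<bullet> (K *v (A *v m t))"
    by (simp add: inner_add_left inner_transpose_left inner_transpose inner_commute[of "b *v u t"] del: transpose_matrix_vector)
  moreover have "expectation (\<lambda>\<omega>. x t \<omega> \<bullet> (lyapunov_op A C K *v x t \<omega>))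
      = expectation (\<lambda>\<omega>. x t \<omega> \<bullet> ((transpose A ** K ** A) *v x t \<omega>))
      + expectation (\<lambda>\<omega>. x t \<omega> \<bullet> ((transpose C ** K ** C) *v x t \<omega>))"
    unfolding lyapunov_op_def matrix_vector_mult_add_rdistrib inner_add_right
    by (rule Bochner_Integration.integral_add[OF integrable_quadratic integrable_quadratic])
  ultimately show ?thesis by linarith
qed

text \<open>A deterministic control shifts state and mean alike, so all terms with
  \<open>u t\<close> cancel. The only new variance comes from the noise acting on the mean through
  \<open>C\<close>.\<close>

lemma covariance_form_Suc:
  "covariance_form K (Suc t) = covariance_form (lyapunov_op A C K) t + (C *v m t) \<bullet> (K *v (C *v m t))"
  unfolding covariance_form_def expectation_quadratic_Suc m_Suc
  by (simp add: lyapunov_op_form matrix_vector_right_distrib inner_add)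

text \<open>Variation of constants: the summand with index \<open>s\<close> is the variance injected
  \<open>s\<close> steps before the last transition, seen through \<open>s\<close> applications of
  the Lyapunov operator.\<close>

lemma covariance_form_eq:
  "covariance_form K t = covariance_form ((lyapunov_op A C ^^ t) K) 0
    + (\<Sum>s<t. (C *v m (t - Suc s)) \<bullet> ((lyapunov_op A C ^^ s) K *v (C *v m (t - Suc s))))"
proof (induction t arbitrary: K)
  case (Suc t)
  show ?case
    unfolding covariance_form_Suc Suc.IH sum.lessThan_Suc_shift
    by (simp add: funpow_swap1)
qed simp

lemma norm_mean_le: "(norm (m t))\<^sup>2 \<le> expectation (\<lambda>\<omega>. (norm (x t \<omega>))\<^sup>2)"
proof -
  have "expectation (\<lambda>\<omega>. 2 * (m t \<bullet> x t \<omega>)) \<le> expectation (\<lambda>\<omega>. (norm (m t))\<^sup>2 + (norm (x t \<omega>))\<^sup>2)"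
  proof (rule integral_mono)
    show "integrable M (\<lambda>\<omega>. 2 * (m t \<bullet> x t \<omega>))"
      by (simp add: integrable_linear)
    show "integrable M (\<lambda>\<omega>. (norm (m t))\<^sup>2 + (norm (x t \<omega>))\<^sup>2)"
      by (simp add: integrable_norm_square)
    show "2 * (m t \<bullet> x t \<omega>) \<le> (norm (m t))\<^sup>2 + (norm (x t \<omega>))\<^sup>2" for \<omega>
      using zero_le_power2[of "norm (m t - x t \<omega>)"]
      unfolding power2_norm_eq_inner by (simp add: inner_diff inner_commute)
  qed
  moreover have "expectation (\<lambda>\<omega>. 2 * (m t \<bullet> x t \<omega>)) = 2 * (norm (m t))\<^sup>2"
    by (simp add: expectation_linear power2_norm_eq_inner)
  moreover have "expectation (\<lambda>\<omega>. (norm (m t))\<^sup>2 + (norm (x t \<omega>))\<^sup>2)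
      = (norm (m t))\<^sup>2 + expectation (\<lambda>\<omega>. (norm (x t \<omega>))\<^sup>2)"
    by (simp add: integrable_norm_square prob_space)
  ultimately show ?thesis by linarith
qed

lemma expectation_quadratic_free:
  assumes "\<And>t. u t = 0"
  shows "expectation (\<lambda>\<omega>. x t \<omega> \<bullet> (K *v x t \<omega>))
    = expectation (\<lambda>\<omega>. a \<omega> \<bullet> ((lyapunov_op A C ^^ t) K *v a \<omega>))"
proof (induction t arbitrary: K)
  case (Suc t)
  show ?case
    unfolding expectation_quadratic_Suc Suc.IH by (simp add: assms funpow_swap1)
qed simp

end

section \<open>Consequences of mean-square stability\<close>

context white_noise
begin

lemma controlled_system_initial_vector:
  "initial_vector a \<Longrightarrow> controlled_system M F \<xi> a"
  unfolding controlled_system_def controlled_system_axioms_def initial_vector_def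
  by (simp add: white_noise_axioms)

context
  fixes A C :: "real ^ 'n ^ 'n" and b :: "real ^ 'm ^ 'n"
  assumes stable: "mean_square_stable A b C"
begin

lemma stable_free_state: "(\<lambda>t. expectation (\<lambda>\<omega>. (norm (state A b C (\<lambda>_. c) (\<lambda>_. 0) t \<omega>))\<^sup>2)) \<longlonglongrightarrow> 0"
  using stable initial_vector_const unfolding mean_square_stable_def by blast

text \<open>The orbit of \<open>c\<close> under \<open>A\<close> is the mean of the uncontrolled
  state started at \<open>c\<close>, and the squared norm of a mean is at most the second
  moment.\<close>

lemma mean_orbit_limit: "(\<lambda>t. (((*v) A) ^^ t) c) \<longlonglongrightarrow> 0"
proof -
  interpret free: controlled_system M F \<xi> A C b "\<lambda>_. c" "\<lambda>_. 0"
    by (rule controlled_system_initial_vector[OF initial_vector_const])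
  have "free.m t = (((*v) A) ^^ t) c" for t
    by (induction t) (simp_all add: free.m_def prob_space)
  then have "(norm ((((*v) A) ^^ t) c))\<^sup>2 \<le> expectation (\<lambda>\<omega>. (norm (free.x t \<omega>))\<^sup>2)" for t
    using free.norm_mean_le[of t] by simp
  then have "(\<lambda>t. (norm ((((*v) A) ^^ t) c))\<^sup>2) \<longlonglongrightarrow> 0"
    by (intro Lim_null_comparison[OF _ stable_free_state[of c]]) simp
  then have "(\<lambda>t. sqrt ((norm ((((*v) A) ^^ t) c))\<^sup>2)) \<longlonglongrightarrow> sqrt 0"
    by (rule tendsto_real_sqrt)
  then show ?thesis
    by (simp add: tendsto_norm_zero_iff)
qed

text \<open>By duality the form of the iterated matrix at \<open>c\<close> is the expected form of
  \<open>K\<close> at the uncontrolled state started at \<open>c\<close>, which the decaying second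
  moment bounds.\<close>

lemma lyapunov_orbit_limit:
  assumes K: "transpose K = K"
  shows "(\<lambda>t. (lyapunov_op A C ^^ t) K) \<longlonglongrightarrow> 0"
proof (rule tendsto_symmetric_zero)
  show "transpose ((lyapunov_op A C ^^ t) K) = (lyapunov_op A C ^^ t) K" for t
    by (rule transpose_lyapunov_op_funpow[OF K])
  fix c
  interpret free: controlled_system M F \<xi> A C b "\<lambda>_. c" "\<lambda>_. 0"
    by (rule controlled_system_initial_vector[OF initial_vector_const])
  have bound: "norm (c \<bullet> ((lyapunov_op A C ^^ t) K *v c)) \<le> norm K * expectation (\<lambda>\<omega>. (norm (free.x t \<omega>))\<^sup>2)" for t
  proof -
    have "c \<bullet> ((lyapunov_op A C ^^ t) K *v c) = expectation (\<lambda>\<omega>. free.x t \<omega> \<bullet> (K *v free.x t \<omega>))"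
      by (simp add: free.expectation_quadratic_free prob_space)
    also have "\<bar>\<dots>\<bar> \<le> expectation (\<lambda>\<omega>. \<bar>free.x t \<omega> \<bullet> (K *v free.x t \<omega>)\<bar>)"
      by (rule integral_abs_bound)
    also have "\<dots> \<le> expectation (\<lambda>\<omega>. norm K * (norm (free.x t \<omega>))\<^sup>2)"
      by (intro integral_mono quadratic_form_bound integrable_abs free.integrable_quadratic
          integrable_mult_right free.integrable_norm_square)
    finally show ?thesis
      by (simp only: real_norm_def Bochner_Integration.integral_mult_right_zero)
  qed
  have "(\<lambda>t. norm K * expectation (\<lambda>\<omega>. (norm (free.x t \<omega>))\<^sup>2)) \<longlonglongrightarrow> norm K * 0"
    by (intro tendsto_mult_left stable_free_state)
  then show "(\<lambda>t. c \<bullet> ((lyapunov_op A C ^^ t) K *v c)) \<longlonglongrightarrow> 0"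
    unfolding mult_zero_right
    by (rule Lim_null_comparison[OF always_eventually[OF allI[OF bound]]])
qed

text \<open>In the variation-of-constants formula the initial part decays with the iterates of the
  Lyapunov operator. The rest is dominated by a convolution of two summable sequences.\<close>

lemma covariance_form_limit:
  assumes K: "transpose K = K" and a: "initial_vector a"
    and m: "summable (\<lambda>t. (norm (controlled_system.m M A b a u t))\<^sup>2)"
  shows "(\<lambda>t. controlled_system.covariance_form M \<xi> A C b a u K t) \<longlonglongrightarrow> 0"
proof -
  interpret controlled_system M F \<xi> A C b a u
    by (rule controlled_system_initial_vector[OF a])
  let ?K = "\<lambda>t. (lyapunov_op A C ^^ t) K"
  have summ: "summable (\<lambda>t. norm (?K t))"
    by (rule summable_lyapunov_orbit[OF lyapunov_orbit_limit K])
  have lim: "(\<lambda>t. norm (?K t)) \<longlonglongrightarrow> 0"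
    by (rule summable_LIMSEQ_zero[OF summ])
  define E where "E = expectation (\<lambda>\<omega>. (norm (a \<omega>))\<^sup>2) + (norm (m 0))\<^sup>2"
  have initial: "\<bar>covariance_form (?K t) 0\<bar> \<le> norm (?K t) * E" for t
  proof -
    have "\<bar>expectation (\<lambda>\<omega>. a \<omega> \<bullet> (?K t *v a \<omega>))\<bar> \<le> expectation (\<lambda>\<omega>. \<bar>a \<omega> \<bullet> (?K t *v a \<omega>)\<bar>)"
      by (rule integral_abs_bound)
    also have "\<dots> \<le> expectation (\<lambda>\<omega>. norm (?K t) * (norm (a \<omega>))\<^sup>2)"
      using integrable_quadratic[of 0]
      by (intro integral_mono quadratic_form_bound integrable_abs integrable_mult_right integrable_a) simp
    finally have "\<bar>expectation (\<lambda>\<omega>. a \<omega> \<bullet> (?K t *v a \<omega>))\<bar> \<le> norm (?K t) * expectation (\<lambda>\<omega>. (norm (a \<omega>))\<^sup>2)"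
      by simp
    with quadratic_form_bound[of "m 0" "?K t"] show ?thesis
      unfolding covariance_form_def E_def distrib_left state.simps by linarith
  qed
  define d where "d t = (norm (C *v m t))\<^sup>2" for t
  have d_abs: "\<bar>d t\<bar> = d t" for t
    by (simp add: d_def)
  obtain c where c: "\<And>v. norm (C *v v) \<le> norm v * c"
    using bounded_linear.bounded[OF matrix_vector_mul_bounded_linear[of C]] by blast
  have "summable d"
  proof (rule summable_comparison_test'[where N = 0])
    show "summable (\<lambda>t. c\<^sup>2 * (norm (m t))\<^sup>2)"
      by (intro summable_mult m)
    show "norm (d t) \<le> c\<^sup>2 * (norm (m t))\<^sup>2" for t
      using power_mono[OF c[of "m t"], of 2] by (simp add: d_def power_mult_distrib mult.commute)
  qed
  \<comment> \<open>The terms of a Cauchy product of absolutely convergent series are summable,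
    hence tend to 0.\<close>
  have "summable (\<lambda>t. \<Sum>s\<le>t. norm (?K s) * d (t - s))"
    using summable_Cauchy_product[of "\<lambda>t. norm (?K t)" d] summ \<open>summable d\<close>
    by (simp add: d_abs)
  then have conv: "(\<lambda>t. \<Sum>s\<le>t. norm (?K s) * d (t - s)) \<longlonglongrightarrow> 0"
    by (rule summable_LIMSEQ_zero)
  \<comment> \<open>At time \<open>Suc t\<close> the sum over \<open>s < Suc t\<close> has exactly
    the indices of the Cauchy coefficient at \<open>t\<close>.\<close>
  have bound: "norm (covariance_form K (Suc t)) \<le> norm (?K (Suc t)) * E + (\<Sum>s\<le>t. norm (?K s) * d (t - s))" for t
  proof -
    have "\<bar>\<Sum>s<Suc t. (C *v m (Suc t - Suc s)) \<bullet> (?K s *v (C *v m (Suc t - Suc s)))\<bar>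
      \<le> (\<Sum>s<Suc t. \<bar>(C *v m (Suc t - Suc s)) \<bullet> (?K s *v (C *v m (Suc t - Suc s)))\<bar>)"
      by (rule sum_abs)
    also have "\<dots> \<le> (\<Sum>s<Suc t. norm (?K s) * d (t - s))"
      unfolding d_def diff_Suc_Suc by (intro sum_mono quadratic_form_bound)
    finally show ?thesis
      unfolding covariance_form_eq[of K "Suc t"] lessThan_Suc_atMost real_norm_def
      using initial[of "Suc t"] by linarith
  qed
  have "(\<lambda>t. norm (?K (Suc t)) * E + (\<Sum>s\<le>t. norm (?K s) * d (t - s))) \<longlonglongrightarrow> 0 * E + 0"
    by (intro tendsto_intros LIMSEQ_Suc[OF lim] conv)
  then have "(\<lambda>t. covariance_form K (Suc t)) \<longlonglongrightarrow> 0"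
    unfolding mult_zero_left add_0_left
    by (rule Lim_null_comparison[OF always_eventually[OF allI[OF bound]]])
  then show ?thesis
    by (rule LIMSEQ_imp_Suc)
qed

end

end

section \<open>Reduction of the stochastic cost to the deterministic one\<close>

context white_noise
begin

context
  fixes A C :: "real ^ 'n ^ 'n" and b :: "real ^ 'm ^ 'n"
  assumes stable: "mean_square_stable A b C"
begin

lemma stable_mean_system: "stable_linear_system ((*v) A) ((*v) b) (form_op \<Theta> \<gamma> \<Gamma>)"
proof (intro stable_linear_system.intro stable_linear_system_axioms.intro linear_system.intro)
  show "(\<lambda>k. ((*v) A ^^ k) x) \<longlonglongrightarrow> 0" for x
    by (rule mean_orbit_limit[OF stable])
qed (rule matrix_vector_mul_linear linear_form_op)+

text \<open>The Lyapunov equation makes the random part of each stage cost a telescoping difference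
  plus a term in the mean. The control enters only through the deterministic cost; the remaining
  constant depends on \<open>a\<close> and \<open>H\<close>.\<close>

lemma cost_eq:
  fixes \<gamma> :: "real ^ 'm ^ 'n" and \<Gamma> :: "real ^ 'm ^ 'm"
  assumes a: "initial_vector a" and u: "summable (\<lambda>t. (norm (u t))\<^sup>2)"
    and H: "transpose H = H" and lyapunov: "lyapunov_op A C H = H - G"
    and \<Theta>: "\<Theta> = transpose C ** H ** C + G"
  shows "cost A b C G \<gamma> \<Gamma> a u = expectation (\<lambda>\<omega>. a \<omega> \<bullet> (H *v a \<omega>))
      - expectation a \<bullet> (H *v expectation a)
    + stable_linear_system.quadratic_cost ((*v) A) ((*v) b) (form_op \<Theta> \<gamma> \<Gamma>) (expectation a) u"
proof -
  interpret lq: stable_linear_system "(*v) A" "(*v) b" "form_op \<Theta> \<gamma> \<Gamma>"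
    by (rule stable_mean_system)
  interpret controlled_system M F \<xi> A C b a u
    by (rule controlled_system_initial_vector[OF a])
  have covariance_G: "covariance_form G t + covariance_form (lyapunov_op A C H) t = covariance_form H t" for t
  proof -
    have "expectation (\<lambda>\<omega>. x t \<omega> \<bullet> ((H - G) *v x t \<omega>))
        = expectation (\<lambda>\<omega>. x t \<omega> \<bullet> (H *v x t \<omega>)) - expectation (\<lambda>\<omega>. x t \<omega> \<bullet> (G *v x t \<omega>))"
      unfolding matrix_vector_mult_diff_rdistrib inner_diff_right
      by (rule Bochner_Integration.integral_diff[OF integrable_quadratic integrable_quadratic])
    then show ?thesis
      unfolding covariance_form_def lyapunov
      by (simp add: matrix_vector_mult_diff_rdistrib inner_diff_right)
  qed
  have stage: "expectation (\<lambda>\<omega>. let y = x t \<omega>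
        in y \<bullet> (G *v y) + 2 * (y \<bullet> (\<gamma> *v u t)) + u t \<bullet> (\<Gamma> *v u t))
      = (covariance_form H t - covariance_form H (Suc t)) + lq.form (m t, u t)" for t
  proof -
    have "expectation (\<lambda>\<omega>. x t \<omega> \<bullet> (G *v x t \<omega>) + 2 * ((\<gamma> *v u t) \<bullet> x t \<omega>) + u t \<bullet> (\<Gamma> *v u t))
        = expectation (\<lambda>\<omega>. x t \<omega> \<bullet> (G *v x t \<omega>)) + 2 * ((\<gamma> *v u t) \<bullet> m t) + u t \<bullet> (\<Gamma> *v u t)"
      by (simp add: integrable_quadratic integrable_linear expectation_linear prob_space)
    also have "expectation (\<lambda>\<omega>. x t \<omega> \<bullet> (G *v x t \<omega>)) = covariance_form G t + m t \<bullet> (G *v m t)"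
      by (simp add: covariance_form_def)
    \<comment> \<open>The term left over from the telescoping difference is what turns the weight
      \<open>G\<close> on the mean into \<open>\<Theta>\<close>.\<close>
    also have "covariance_form G t
        = covariance_form H t - covariance_form H (Suc t) + (C *v m t) \<bullet> (H *v (C *v m t))"
      using covariance_G[of t] by (simp add: covariance_form_Suc)
    finally show ?thesis
      unfolding lq.form_def inner_form_op unfolding \<Theta> Let_def
      by (simp add: matrix_vector_mult_add_rdistrib inner_add_right
          quadratic_form_congruence inner_commute[of "\<gamma> *v u t"])
  qed
  have m: "m t = lq.trajectory (expectation a) u t" for t
    by (simp add: m_def)
  have "covariance_form H \<longlonglongrightarrow> 0"
    by (rule covariance_form_limit[OF stable H a])
      (simp add: m lq.square_summable_trajectory[OF u])
  \<comment> \<open>The limit 0 of the covariance form leaves only its initial value after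
    telescoping.\<close>
  then have "(\<lambda>t. covariance_form H t - covariance_form H (Suc t)) sums (covariance_form H 0 - 0)"
    by (rule telescope_sums')
  moreover have "(\<lambda>t. lq.form (m t, u t)) sums lq.quadratic_cost (expectation a) u"
    unfolding lq.quadratic_cost_def m by (rule summable_sums[OF lq.summable_form[OF u]])
  ultimately have "(\<lambda>t. (covariance_form H t - covariance_form H (Suc t)) + lq.form (m t, u t))
      sums (covariance_form H 0 - 0 + lq.quadratic_cost (expectation a) u)"
    by (rule sums_add)
  then show ?thesis
    unfolding cost_def stage by (simp add: sums_iff covariance_form_def m)
qed

end

end

section \<open>Transfer to the complex frequency condition and conclusion\<close>

lemma harmonic_iff:
  assumes "stable_linear_system ((*v) A) ((*v) b) S"
  shows "linear_system.harmonic ((*v) A) ((*v) b) \<theta> (re_vec g) (im_vec g) (re_vec w) (im_vec w)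
    \<longleftrightarrow> cis \<theta> *s g = cmat A *v g + cmat b *v w"
proof -
  interpret stable_linear_system "(*v) A" "(*v) b" S by fact
  show ?thesis
    unfolding harmonic_def complex_vec_eq_iff
    by (simp add: re_vec_add im_vec_add re_vec_scale im_vec_scale re_vec_cmat im_vec_cmat)
qed

theorem theorem3p1:
  fixes M :: "'w measure" and F :: "nat \<Rightarrow> 'w measure" and \<xi> :: "nat \<Rightarrow> 'w \<Rightarrow> real"
    and a :: "'w \<Rightarrow> real ^ 'n"
    and A C G :: "real ^ 'n ^ 'n" and b \<gamma> :: "real ^ 'm ^ 'n" and \<Gamma> :: "real ^ 'm ^ 'm"
    and H \<Theta> :: "complex ^ 'n ^ 'n"
    and u\<^sub>o :: "nat \<Rightarrow> real ^ 'm"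
  assumes "white_noise M F \<xi>"
    and "white_noise.initial_vector M F \<xi> a"
    and "transpose G = G" and "transpose \<Gamma> = \<Gamma>"
    and "spectral_radius (cmat A) < 1"
    and "white_noise.mean_square_stable M F \<xi> A b C"
    and "transpose H = H" and "transpose \<Theta> = \<Theta>"
    and "transpose (cmat A) ** H ** cmat A - H + \<Theta> = 0"
    and "\<Theta> - transpose (cmat C) ** H ** cmat C - cmat G = 0"
    and "u\<^sub>o \<in> controls"
    and "\<forall>u\<in>controls. white_noise.cost M \<xi> A b C G \<gamma> \<Gamma> a u\<^sub>o \<le> white_noise.cost M \<xi> A b C G \<gamma> \<Gamma> a u"
  shows "(\<forall>z u. cmod z = 1 \<longrightarrow>
      0 \<le> frequency_form \<Theta> \<gamma> \<Gamma> (resolvent A z *v (cmat b *v u)) u) \<and>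
    ((\<exists>\<delta>>0. \<forall>z u. cmod z = 1 \<longrightarrow>
        complex_of_real (\<delta> * (norm u)\<^sup>2)
          \<le> frequency_form \<Theta> \<gamma> \<Gamma> (resolvent A z *v (cmat b *v u)) u) \<longrightarrow>
      (\<forall>u\<in>controls. \<forall>v\<in>controls.
        (\<forall>w\<in>controls. white_noise.cost M \<xi> A b C G \<gamma> \<Gamma> a u \<le> white_noise.cost M \<xi> A b C G \<gamma> \<Gamma> a w) \<longrightarrow>
        (\<forall>w\<in>controls. white_noise.cost M \<xi> A b C G \<gamma> \<Gamma> a v \<le> white_noise.cost M \<xi> A b C G \<gamma> \<Gamma> a w) \<longrightarrow>
        (\<lambda>t. (norm (u t - v t))\<^sup>2) sums 0))"
proof -
  interpret white_noise M F \<xi> by fact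
  note a = \<open>initial_vector a\<close> and stable = \<open>mean_square_stable A b C\<close>
  define H\<^sub>r H\<^sub>i where "H\<^sub>r = map_matrix Re H" and "H\<^sub>i = map_matrix Im H"
  have sym_Hr: "transpose H\<^sub>r = H\<^sub>r" and sym_Hi: "transpose H\<^sub>i = H\<^sub>i"
    using \<open>transpose H = H\<close> by (auto simp: H\<^sub>r_def H\<^sub>i_def vec_eq_iff transpose_def)
  have \<Theta>_eq: "\<Theta> = cmat (transpose C) ** H ** cmat C + cmat G"
    using \<open>\<Theta> - _ - _ = 0\<close> by (simp add: transpose_cmat algebra_simps)
  have "cmat (transpose A) ** H ** cmat A + \<Theta> = H"
    using \<open>_ - H + \<Theta> = 0\<close> by (simp add: transpose_cmat algebra_simps)
  then have "cmat (transpose A) ** H ** cmat A + cmat (transpose C) ** H ** cmat C + cmat G = H"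
    by (simp add: \<Theta>_eq add.assoc)
  then have "map_matrix Re (cmat (transpose A) ** H ** cmat A)
        + map_matrix Re (cmat (transpose C) ** H ** cmat C) + G = H\<^sub>r"
      "map_matrix Im (cmat (transpose A) ** H ** cmat A)
        + map_matrix Im (cmat (transpose C) ** H ** cmat C) = H\<^sub>i"
    by (auto simp: H\<^sub>r_def H\<^sub>i_def vec_eq_iff complex_eq_iff)
  then have lyapunov: "lyapunov_op A C H\<^sub>r = H\<^sub>r - G" and lyapunov_Im: "lyapunov_op A C H\<^sub>i = H\<^sub>i"
    by (auto simp: map_matrix_Re_Im lyapunov_op_def H\<^sub>r_def H\<^sub>i_def algebra_simps)
  \<comment> \<open>\<open>G\<close> is real, so the imaginary part of \<open>H\<close> is a fixed
    point of the Lyapunov operator. Its constant orbit must also tend to 0.\<close>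
  have "(lyapunov_op A C ^^ t) H\<^sub>i = H\<^sub>i" for t
    by (induction t) (simp_all add: lyapunov_Im)
  then have "H\<^sub>i = 0"
    using lyapunov_orbit_limit[OF stable sym_Hi] by (simp add: LIMSEQ_const_iff)
  define \<Theta>\<^sub>r where "\<Theta>\<^sub>r = transpose C ** H\<^sub>r ** C + G"
  have "map_matrix Re \<Theta> = \<Theta>\<^sub>r"
    using map_matrix_Re_Im(3)[of "cmat (transpose C) ** H" C] map_matrix_Re_Im(1)[of "transpose C" H]
    by (simp add: \<Theta>_eq \<Theta>\<^sub>r_def H\<^sub>r_def vec_eq_iff)
  moreover have "map_matrix Im \<Theta> = transpose C ** H\<^sub>i ** C"
    using map_matrix_Re_Im(4)[of "cmat (transpose C) ** H" C] map_matrix_Re_Im(2)[of "transpose C" H]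
    by (simp add: \<Theta>_eq H\<^sub>i_def vec_eq_iff)
  then have "map_matrix Im \<Theta> = 0"
    by (simp add: \<open>H\<^sub>i = 0\<close>)
  ultimately have \<Theta>_real: "\<Theta> = cmat \<Theta>\<^sub>r"
    by (auto simp: complex_mat_eq_iff vec_eq_iff)
  have sym_\<Theta>: "transpose \<Theta>\<^sub>r = \<Theta>\<^sub>r"
    using \<open>transpose \<Theta> = \<Theta>\<close> by (auto simp: \<Theta>_real vec_eq_iff transpose_def)
  note system = stable_mean_system[OF stable, of \<Theta>\<^sub>r \<gamma> \<Gamma>]
  interpret lq: stable_linear_system "(*v) A" "(*v) b" "form_op \<Theta>\<^sub>r \<gamma> \<Gamma>"
    by (rule system)
  have form: "frequency_form \<Theta> \<gamma> \<Gamma> x w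
      = complex_of_real (lq.form (re_vec x, re_vec w) + lq.form (im_vec x, im_vec w))" for x w
    by (simp add: \<Theta>_real frequency_form_eq[OF sym_\<Theta> \<open>transpose \<Gamma> = \<Gamma>\<close>] lq.form_def inner_form_op)
  \<comment> \<open>\<open>harmonic_zero\<close> excludes eigenvalues of \<open>A\<close> on the
    unit circle, which is the kernel condition behind \<open>resolvent_equation\<close>.\<close>
  have resolvent: "lq.harmonic \<theta> (re_vec g) (im_vec g) (re_vec w) (im_vec w)
      \<longleftrightarrow> g = resolvent A (cis \<theta>) *v (cmat b *v w)" for \<theta> g w
    unfolding harmonic_iff[OF system]
  proof (rule resolvent_equation)
    fix x assume "cis \<theta> *s x = cmat A *v x"
    then have "cis \<theta> *s x = cmat A *v x + cmat b *v 0"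
      by simp
    then have "lq.harmonic \<theta> (re_vec x) (im_vec x) (re_vec 0) (im_vec 0)"
      unfolding harmonic_iff[OF system] .
    moreover have "re_vec 0 = (0 :: real ^ 'm)" "im_vec 0 = (0 :: real ^ 'm)"
      by (simp_all add: vec_eq_iff)
    ultimately have "re_vec x = 0 \<and> im_vec x = 0"
      by (simp add: lq.harmonic_zero)
    then show "x = 0"
      by (simp add: complex_vec_eq_iff) (simp add: vec_eq_iff)
  qed
  \<comment> \<open>By \<open>cost_eq\<close> both costs contain the same constant, so comparing
    controls is a deterministic question.\<close>
  have cost: "cost A b C G \<gamma> \<Gamma> a u \<le> cost A b C G \<gamma> \<Gamma> a v
      \<longleftrightarrow> lq.quadratic_cost (expectation a) u \<le> lq.quadratic_cost (expectation a) v"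
    if "u \<in> controls" "v \<in> controls" for u v
    using that cost_eq[OF stable a _ sym_Hr lyapunov \<Theta>\<^sub>r_def] by (simp add: controls_def)
  have minimizer: "lq.quadratic_cost (expectation a) u \<le> lq.quadratic_cost (expectation a) w"
    if "u \<in> controls" "\<forall>w\<in>controls. cost A b C G \<gamma> \<Gamma> a u \<le> cost A b C G \<gamma> \<Gamma> a w"
      "summable (\<lambda>t. (norm (w t))\<^sup>2)" for u w
    using cost[of u w] that by (simp add: controls_def)
  have unit: "\<exists>\<theta>. z = cis \<theta>" if "cmod z = 1" for z
    using rcis_cmod_Arg[of z] that by (metis mult_1 of_real_1 rcis_def)
  show ?thesis
  proof (intro conjI allI impI ballI)
    fix z :: complex and w :: "complex ^ 'm"
    assume "cmod z = 1"
    then obtain \<theta> where z: "z = cis \<theta>"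
      using unit by blast
    let ?g = "resolvent A z *v (cmat b *v w)"
    have "lq.harmonic \<theta> (re_vec ?g) (im_vec ?g) (re_vec w) (im_vec w)"
      by (simp add: resolvent z)
    \<comment> \<open>Minimality concerns the cost started at the mean of \<open>a\<close>;
      \<open>minimizer_cost_nonneg\<close> transfers it to the cost started at 0.\<close>
    then have "0 \<le> lq.form (re_vec ?g, re_vec w) + lq.form (im_vec ?g, im_vec w)"
    proof (rule lq.frequency_nonneg[rotated])
      fix v :: "nat \<Rightarrow> real ^ 'm"
      assume "summable (\<lambda>t. (norm (v t))\<^sup>2)"
      then show "0 \<le> lq.quadratic_cost 0 v"
        using lq.minimizer_cost_nonneg[of u\<^sub>o "expectation a" v] minimizer[of u\<^sub>o] assms(11,12)
        by (simp add: controls_def)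
    qed
    then show "0 \<le> frequency_form \<Theta> \<gamma> \<Gamma> ?g w"
      unfolding form by (simp add: less_eq_complex_def)
  next
    fix u v :: "nat \<Rightarrow> real ^ 'm"
    assume "\<exists>\<delta>>0. \<forall>z u. cmod z = 1 \<longrightarrow> complex_of_real (\<delta> * (norm u)\<^sup>2)
        \<le> frequency_form \<Theta> \<gamma> \<Gamma> (resolvent A z *v (cmat b *v u)) u"
    then obtain \<delta> where "\<delta> > 0" and \<delta>: "\<And>z w. cmod z = 1 \<Longrightarrow> complex_of_real (\<delta> * (norm w)\<^sup>2)
        \<le> frequency_form \<Theta> \<gamma> \<Gamma> (resolvent A z *v (cmat b *v w)) w"
      by blast
    assume u: "u \<in> controls" "\<forall>w\<in>controls. cost A b C G \<gamma> \<Gamma> a u \<le> cost A b C G \<gamma> \<Gamma> a w"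
      and v: "v \<in> controls" "\<forall>w\<in>controls. cost A b C G \<gamma> \<Gamma> a v \<le> cost A b C G \<gamma> \<Gamma> a w"
    have "u t = v t" for t
    proof (rule lq.minimizer_unique[OF \<open>\<delta> > 0\<close> _ _ _ minimizer[OF u] minimizer[OF v]])
      fix \<theta> g h p q
      assume harm: "lq.harmonic \<theta> g h p q"
      \<comment> \<open>The real pairs are reassembled into complex vectors;
        \<open>resolvent\<close> then forces \<open>x\<close> to be the vector for which the
        hypothesis on \<delta> is stated.\<close>
      define x w where "x = (\<chi> i. Complex (g $ i) (h $ i))" and "w = (\<chi> i. Complex (p $ i) (q $ i))"
      have parts: "re_vec x = g" "im_vec x = h" "re_vec w = p" "im_vec w = q"
        by (simp_all add: x_def w_def vec_eq_iff)
      have "x = resolvent A (cis \<theta>) *v (cmat b *v w)"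
        using harm resolvent[of \<theta> x w] unfolding parts by blast
      then have "complex_of_real (\<delta> * (norm w)\<^sup>2) \<le> frequency_form \<Theta> \<gamma> \<Gamma> x w"
        using \<delta>[of "cis \<theta>" w] by simp
      then show "\<delta> * ((norm p)\<^sup>2 + (norm q)\<^sup>2) \<le> lq.form (g, p) + lq.form (h, q)"
        unfolding form norm_complex_vec parts by (simp add: less_eq_complex_def)
    qed (use u v in \<open>simp_all add: controls_def\<close>)
    then show "(\<lambda>t. (norm (u t - v t))\<^sup>2) sums 0"
      by simp
  qed
qed

end
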